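(* There is a dimensional constant $c_n>1$ such that for every $A_\infty$ weight $w$ on $\mathbb{R}^n$ we have $w\in A_p$ for every $p>e^{c_n[w]_{A_\infty}}$, with $[w]_{A_p}\le e^{e^{c_n[w]_{A_\infty}}}$.
   Context: Cubes are axis-parallel cubes in $\mathbb{R}^n$. A weight is a non-negative locally integrable function $w$, $w(Q)=\int_Q w$. $\mathsf{M}$ is the uncentered Hardy–Littlewood maximal operator over cubes with respect to Lebesgue measure. The Fujii–Wilson constant is $[w]_{A_\infty}=\sup_Q\frac{1}{w(Q)}\int_Q\mathsf{M}(w\chi_Q)$, and $A_\infty$ is the class of weights for which it is finite. For $p>1$, $[w]_{A_p}=\sup_Q\big(\frac{1}{|Q|}\int_Q w\big)\big(\frac{1}{|Q|}\int_Q w^{-\frac{1}{p-1}}\big)^{p-1}$ and $A_p$ is the class of weights with $[w]_{A_p}<\infty$. *)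

theory Defs
  imports "HOL-Analysis.Analysis"
begin

definition cube :: "'a::euclidean_space set \<Rightarrow> bool" where
  "cube Q \<longleftrightarrow> (\<exists>a r. r > 0 \<and> Q = cbox a (a + r *\<^sub>R One))"

definition weight :: "('a::euclidean_space \<Rightarrow> real) \<Rightarrow> bool" where
  "weight w \<longleftrightarrow> (\<forall>x. 0 \<le> w x) \<and> w \<in> borel_measurable lebesgue \<and>
     (\<forall>K. compact K \<longrightarrow> set_integrable lebesgue K w)"

definition avg :: "('a::euclidean_space \<Rightarrow> ennreal) \<Rightarrow> 'a set \<Rightarrow> ennreal" where
  "avg f Q = (\<integral>\<^sup>+x\<in>Q. f x \<partial>lebesgue) / emeasure lebesgue Q"

definition maxop :: "('a::euclidean_space \<Rightarrow> ennreal) \<Rightarrow> 'a \<Rightarrow> ennreal" where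
  "maxop f x = (SUP Q\<in>{Q. cube Q \<and> x \<in> Q}. avg f Q)"

definition Ainf_const :: "('a::euclidean_space \<Rightarrow> real) \<Rightarrow> ennreal" where
  "Ainf_const w = (SUP Q\<in>{Q. cube Q}.
      (\<integral>\<^sup>+x\<in>Q. maxop (\<lambda>y. ennreal (w y) * indicator Q y) x \<partial>lebesgue)
      / (\<integral>\<^sup>+x\<in>Q. ennreal (w x) \<partial>lebesgue))"

text \<open>Real power of an extended non-negative real (infinity stays infinity, exponent > 0).\<close>
definition epowr :: "ennreal \<Rightarrow> real \<Rightarrow> ennreal" where
  "epowr X s = (if X = \<infinity> then \<infinity> else ennreal (enn2real X powr s))"

definition Ap_const :: "real \<Rightarrow> ('a::euclidean_space \<Rightarrow> real) \<Rightarrow> ennreal" where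
  "Ap_const p w = (SUP Q\<in>{Q. cube Q}.
      avg (\<lambda>x. ennreal (w x)) Q *
      epowr (avg (\<lambda>x. if w x = 0 then \<infinity> else ennreal (w x powr (-1 / (p - 1)))) Q) (p - 1))"

definition A_p :: "real \<Rightarrow> ('a::euclidean_space \<Rightarrow> real) set" where
  "A_p p = {w. weight w \<and> Ap_const p w < \<infinity>}"

definition A_inf :: "('a::euclidean_space \<Rightarrow> real) set" where
  "A_inf = {w. weight w \<and> Ainf_const w < \<infinity>}"

end

theory Submission
  imports Defs
begin

text \<open>
  Write \<open>W\<close> for the measure with density \<open>w\<close> and \<open>A\<close> for the Fujii--Wilson constant. On a cube \<open>Q\<close>
  with average \<open>s\<close>, let \<open>X\<^sub>j\<close> be the union of the dyadic subcubes whose average exceeds \<open>2\<^sup>j s\<close>. Then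
  \<open>W(X\<^sub>j) \<le> 2\<^sup>n 2\<^sup>j s |X\<^sub>j|\<close>, and \<open>\<Sum>\<^sub>j 2\<^sup>j s \<chi>(X\<^sub>j)\<close> is at most twice the maximal function, so for \<open>m\<close> of
  order \<open>A\<close> one gets \<open>W(X\<^sub>m) \<le> W(Q)/4\<close>. Since the averages off \<open>X\<^sub>m\<close> are at most \<open>2\<^sup>m s\<close>, sets \<open>E\<close> with
  \<open>|E| \<le> \<eta>|Q|\<close>, where \<open>\<eta> = 2\<close> to the power \<open>-m-2\<close>, satisfy \<open>W(E) \<le> W(Q)/2\<close>. No reverse Hoelder inequality is
  needed.

  Enlarging a cube by a factor \<open>1 + \<eta>/n\<close> at most doubles \<open>W\<close>, so a dyadic child carries at least \<open>2\<close> to the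
  power \<open>-J\<close> of the mass of its parent, with \<open>J = n/\<eta>\<close>. Hence, in the sets where the dyadic averages of \<open>w\<close>
  fall below \<open>s\<close> divided by the \<open>k\<close>-th power of \<open>4 \<cdot> 2\<^sup>J\<close>, each set is at most \<open>1 - \<eta>\<close> times the previous one
  in Lebesgue measure. This makes \<open>w\<close> to the power \<open>-\<delta>\<close> integrable for \<open>\<delta>\<close> of order \<open>\<eta>/J\<close>, and both \<open>1/\<eta>\<close>
  and \<open>J\<close> are exponential in \<open>A\<close>.
\<close>

section \<open>Dyadic cells and stopping times\<close>

text \<open>The half-open cell of generation \<open>k\<close> through \<open>x\<close> in the grid
  with origin \<open>a\<close> and initial side \<open>r\<close>. Naming a cell by any of its points
  makes it an equivalence class, so nesting and disjointness reduce to arithmetic of floors; for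
  \<open>r > 0\<close>, \<open>dcell a r 0 a\<close> is the starting cube without its upper
  faces.\<close>

definition dcell :: "'a::euclidean_space \<Rightarrow> real \<Rightarrow> nat \<Rightarrow> 'a \<Rightarrow> 'a set" where
  "dcell a r k x = {y. \<forall>i\<in>Basis. \<lfloor>2 ^ k * ((y - a) \<bullet> i) / r\<rfloor> = \<lfloor>2 ^ k * ((x - a) \<bullet> i) / r\<rfloor>}"

definition dcorner :: "'a::euclidean_space \<Rightarrow> real \<Rightarrow> nat \<Rightarrow> 'a \<Rightarrow> 'a" where
  "dcorner a r k x = a + (\<Sum>i\<in>Basis. (r / 2 ^ k * of_int \<lfloor>2 ^ k * ((x - a) \<bullet> i) / r\<rfloor>) *\<^sub>R i)"

text \<open>The closure of the cell when \<open>r > 0\<close>. Half-open cells give exact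
  partitions, whereas the constants of the weight refer to closed cubes; the two differ by a null
  set.\<close>

definition dcube :: "'a::euclidean_space \<Rightarrow> real \<Rightarrow> nat \<Rightarrow> 'a \<Rightarrow> 'a set" where
  "dcube a r k x = cbox (dcorner a r k x) (dcorner a r k x + (r / 2 ^ k) *\<^sub>R One)"

lemma dcell_self [simp]: "x \<in> dcell a r k x"
  by (simp add: dcell_def)

lemma dcell_eq: "y \<in> dcell a r k x \<Longrightarrow> dcell a r k y = dcell a r k x"
  by (simp add: dcell_def)

lemma dcube_eq: "y \<in> dcell a r k x \<Longrightarrow> dcube a r k y = dcube a r k x"
  by (simp add: dcell_def dcube_def dcorner_def)

lemma floor_div_power2:
  fixes u :: real
  shows "\<lfloor>2 ^ k * u / r\<rfloor> = \<lfloor>2 ^ Suc k * u / r\<rfloor> div 2"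
  by (subst floor_divide_real_eq_div[symmetric]) auto

lemma dcell_Suc_subset: "dcell a r (Suc k) x \<subseteq> dcell a r k x"
  unfolding dcell_def using floor_div_power2[of k _ r] by auto

lemma dcell_antimono: "j \<le> k \<Longrightarrow> dcell a r k x \<subseteq> dcell a r j x"
  by (rule lift_Suc_antimono_le[of "\<lambda>k. dcell a r k x"]) (simp_all add: dcell_Suc_subset)

lemma dcell_mono_eq: "j \<le> k \<Longrightarrow> y \<in> dcell a r k x \<Longrightarrow> dcell a r j y = dcell a r j x"
  using dcell_antimono[of j k a r x] dcell_eq by blast

lemma dcorner_inner:
  assumes "i \<in> Basis"
  shows "dcorner a r k x \<bullet> i = a \<bullet> i + r / 2 ^ k * of_int \<lfloor>2 ^ k * ((x - a) \<bullet> i) / r\<rfloor>"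
  using assms by (simp add: dcorner_def inner_add_left inner_sum_left_Basis)

lemma dcell_iff:
  assumes "r > 0"
  shows "y \<in> dcell a r k x \<longleftrightarrow>
    (\<forall>i\<in>Basis. dcorner a r k x \<bullet> i \<le> y \<bullet> i \<and> y \<bullet> i < dcorner a r k x \<bullet> i + r / 2 ^ k)"
proof -
  have "\<lfloor>2 ^ k * ((y - a) \<bullet> i) / r\<rfloor> = z \<longleftrightarrow>
     a \<bullet> i + r / 2 ^ k * of_int z \<le> y \<bullet> i \<and> y \<bullet> i < a \<bullet> i + r / 2 ^ k * of_int z + r / 2 ^ k" for i and z :: int
    using assms unfolding floor_eq_iff by (auto simp: field_simps inner_diff_left)
  then show ?thesis
    by (auto simp: dcell_def dcorner_inner)
qed

lemma dcell_subset_dcube: "r > 0 \<Longrightarrow> dcell a r k x \<subseteq> dcube a r k x"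
  by (auto simp: dcell_iff dcube_def mem_box inner_add_left less_imp_le)

lemma box_subset_dcell:
  "r > 0 \<Longrightarrow> box (dcorner a r k x) (dcorner a r k x + (r / 2 ^ k) *\<^sub>R One) \<subseteq> dcell a r k x"
  by (auto simp: dcell_iff mem_box inner_add_left less_imp_le)

lemma cube_dcube: "r > 0 \<Longrightarrow> cube (dcube a r k x)"
  by (auto simp: cube_def dcube_def intro!: exI[of _ "r / 2 ^ k"])

lemma dcube_diff_dcell_null:
  assumes "r > 0"
  shows "dcube a r k x - dcell a r k x \<in> null_sets lebesgue"
proof -
  have "negligible (dcube a r k x - dcell a r k x)"
    unfolding dcube_def
    by (rule negligible_subset[OF negligible_frontier_interval])
       (use box_subset_dcell[OF assms, of a k x] in auto)
  then show ?thesis by (simp add: negligible_iff_null_sets)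
qed

lemma sets_dcell [measurable]:
  assumes "r > 0" shows "dcell a r k x \<in> sets lebesgue"
proof -
  have "dcell a r k x = dcube a r k x - (dcube a r k x - dcell a r k x)"
    using dcell_subset_dcube[OF assms] by blast
  moreover have "dcube a r k x \<in> sets lebesgue" by (simp add: dcube_def)
  moreover have "dcube a r k x - dcell a r k x \<in> sets lebesgue"
    using dcube_diff_dcell_null[OF assms] by auto
  ultimately show ?thesis by (metis sets.Diff)
qed

lemma emeasure_dcell_eq_dcube:
  assumes "r > 0" "sets \<mu> = sets lebesgue" "absolutely_continuous lebesgue \<mu>"
  shows "emeasure \<mu> (dcell a r k x) = emeasure \<mu> (dcube a r k x)"
proof -
  have n: "dcube a r k x - dcell a r k x \<in> null_sets \<mu>"
    using dcube_diff_dcell_null[OF assms(1)] assms(3) by (auto simp: absolutely_continuous_def)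
  have "dcube a r k x = dcell a r k x \<union> (dcube a r k x - dcell a r k x)"
    using dcell_subset_dcube[OF assms(1)] by blast
  then show ?thesis
    using emeasure_Un_null_set[OF _ n, of "dcell a r k x"] sets_dcell[OF assms(1)] assms(2) by metis
qed

lemma emeasure_lebesgue_cube:
  fixes a :: "'a::euclidean_space"
  assumes "r \<ge> 0"
  shows "emeasure lebesgue (cbox a (a + r *\<^sub>R One)) = ennreal (r ^ DIM('a))"
  using assms by (simp add: emeasure_lborel_cbox_eq inner_add_left)

lemma emeasure_lebesgue_dcell:
  fixes a :: "'a::euclidean_space"
  assumes "r > 0"
  shows "emeasure lebesgue (dcell a r k x) = ennreal ((r / 2 ^ k) ^ DIM('a))"
proof -
  have "emeasure lebesgue (dcell a r k x) = emeasure lebesgue (dcube a r k x)"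
    by (rule emeasure_dcell_eq_dcube[OF assms]) (auto simp: absolutely_continuous_def)
  then show ?thesis
    using assms emeasure_lebesgue_cube[of "r / 2 ^ k"] by (simp add: dcube_def)
qed

lemma dcorner_0:
  assumes "r > 0" "x \<in> dcell a r 0 a"
  shows "dcorner a r 0 x = a"
proof -
  have "\<lfloor>((x - a) \<bullet> i) / r\<rfloor> = 0" if "i \<in> Basis" for i
    using assms that by (auto simp: dcell_def)
  then show ?thesis by (simp add: dcorner_def)
qed

lemma dcube_0: "r > 0 \<Longrightarrow> dcube a r 0 a = cbox a (a + r *\<^sub>R One)"
  by (simp add: dcube_def dcorner_0)

lemma dcube_Suc_subset:
  assumes "r > 0"
  shows "dcube a r (Suc k) x \<subseteq> dcube a r k x"
proof -
  have "dcorner a r k x \<bullet> i \<le> dcorner a r (Suc k) x \<bullet> i \<and>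
    dcorner a r (Suc k) x \<bullet> i + r / 2 ^ Suc k \<le> dcorner a r k x \<bullet> i + r / 2 ^ k" if "i \<in> Basis" for i
  proof -
    define z where "z = \<lfloor>2 ^ Suc k * ((x - a) \<bullet> i) / r\<rfloor>"
    \<comment> \<open>In this coordinate the parent has index \<open>z div 2\<close>, so the child
      occupies its lower or its upper half.\<close>
    have z: "2 * (z div 2) \<le> z" "z \<le> 2 * (z div 2) + 1" by auto
    have z': "real_of_int (2 * (z div 2)) \<le> z" "real_of_int z \<le> 2 * (z div 2) + 1"
      using z by linarith+
    have 1: "dcorner a r (Suc k) x \<bullet> i = a \<bullet> i + r / 2 ^ Suc k * z"
      using that by (simp add: dcorner_inner z_def)
    have 2: "dcorner a r k x \<bullet> i = a \<bullet> i + r / 2 ^ Suc k * (2 * (z div 2))"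
      using that by (simp add: dcorner_inner z_def floor_div_power2[of k _ r])
    have p: "0 < r / 2 ^ Suc k" using assms by simp
    have "r / 2 ^ Suc k * real_of_int (2 * (z div 2)) \<le> r / 2 ^ Suc k * z"
      "r / 2 ^ Suc k * real_of_int z \<le> r / 2 ^ Suc k * (2 * (z div 2) + 1)"
      using z' p by (intro mult_left_mono; simp)+
    moreover have "r / 2 ^ k = r / 2 ^ Suc k + r / 2 ^ Suc k" by simp
    ultimately show ?thesis unfolding 1 2 by (simp add: algebra_simps)
  qed
  then show ?thesis
    unfolding dcube_def by (subst subset_box) (auto simp: inner_add_left)
qed

lemma dcube_antimono: "r > 0 \<Longrightarrow> j \<le> k \<Longrightarrow> dcube a r k x \<subseteq> dcube a r j x"
  by (rule lift_Suc_antimono_le[of "\<lambda>k. dcube a r k x"]) (simp_all add: dcube_Suc_subset)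

lemma dcell_small:
  fixes a :: "'a::euclidean_space"
  assumes "r > 0" "open U" "x \<in> U"
  shows "\<exists>k. dcell a r k x \<subseteq> U"
proof -
  obtain e where e: "e > 0" "ball x e \<subseteq> U" using assms by (meson open_contains_ball)
  \<comment> \<open>The distance is at most the sum of the \<open>DIM('a)\<close> coordinate
    differences, each at most \<open>r / 2 ^ k\<close>.\<close>
  obtain k where k: "real DIM('a) * r / e < 2 ^ k"
    using real_arch_pow[of 2 "real DIM('a) * r / e"] by auto
  have "y \<in> ball x e" if y: "y \<in> dcell a r k x" for y
  proof -
    have "\<bar>(x - y) \<bullet> i\<bar> \<le> r / 2 ^ k" if "i \<in> Basis" for i
    proof -
      have "dcorner a r k x \<bullet> i \<le> y \<bullet> i" "y \<bullet> i < dcorner a r k x \<bullet> i + r / 2 ^ k"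
        using that y[unfolded dcell_iff[OF assms(1)]] by auto
      moreover have "dcorner a r k x \<bullet> i \<le> x \<bullet> i" "x \<bullet> i < dcorner a r k x \<bullet> i + r / 2 ^ k"
        using that dcell_self[of x a r k, unfolded dcell_iff[OF assms(1)]] by auto
      ultimately show ?thesis by (simp add: inner_diff_left abs_le_iff)
    qed
    then have "(\<Sum>i\<in>Basis. \<bar>(x - y) \<bullet> i\<bar>) \<le> real DIM('a) * (r / 2 ^ k)"
      by (intro sum_bounded_above) auto
    then have "norm (x - y) \<le> real DIM('a) * (r / 2 ^ k)"
      using norm_le_l1[of "x - y"] by linarith
    also have "\<dots> < e" using k e assms by (simp add: field_simps)
    finally show ?thesis by (simp add: dist_norm)
  qed
  then show ?thesis using e by blast
qed

lemma countable_dcells: "countable (range (dcell a r k))"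
proof -
  define g :: "'a \<Rightarrow> 'a \<Rightarrow> int" where "g x = restrict (\<lambda>i. \<lfloor>2 ^ k * ((x - a) \<bullet> i) / r\<rfloor>) Basis" for x
  have eq: "dcell a r k x = {y. g y = g x}" for x
    by (auto simp: dcell_def g_def fun_eq_iff restrict_def)
  have "countable (range g)"
    by (rule countable_subset[OF _ countable_PiE[of Basis "\<lambda>_. UNIV"]]) (auto simp: g_def)
  moreover have "range (dcell a r k) = (\<lambda>v. {y. g y = v}) ` range g"
    by (auto simp: eq)
  ultimately show ?thesis by simp
qed

text \<open>The cells that are stopped for the first time are pairwise disjoint, so a
  comparison of two measures on them passes to the set where stopping occurs.\<close>

lemma stopped_cells:
  fixes a :: "'a::euclidean_space"
  assumes r: "r > 0"
    and cong: "\<And>k x y. y \<in> dcell a r k x \<Longrightarrow> S k x \<Longrightarrow> S k y"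
  shows stopped_sets: "{x. \<exists>k. S k x} \<in> sets lebesgue"
    and stopped_le: "sets \<mu> = sets lebesgue \<Longrightarrow> sets \<nu> = sets lebesgue \<Longrightarrow>
      (\<And>k x. S k x \<Longrightarrow> (\<forall>j<k. \<not> S j x) \<Longrightarrow> emeasure \<mu> (dcell a r k x) \<le> emeasure \<nu> (dcell a r k x)) \<Longrightarrow>
      emeasure \<mu> {x. \<exists>k. S k x} \<le> emeasure \<nu> {x. \<exists>k. S k x}"
proof -
  define C where "C = {dcell a r k x | k x. S k x \<and> (\<forall>j<k. \<not> S j x)}"
  have "C \<subseteq> (\<Union>k. range (dcell a r k))" by (auto simp: C_def)
  then have cC: "countable C"
    by (rule countable_subset) (auto intro: countable_dcells)
  have U: "{x. \<exists>k. S k x} = \<Union>((\<lambda>A. A) ` C)"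
  proof (intro set_eqI iffI)
    fix x assume "x \<in> {x. \<exists>k. S k x}"
    then obtain k where "S k x" "\<forall>j<k. \<not> S j x"
      using exists_least_iff[of "\<lambda>k. S k x"] by auto
    then have "dcell a r k x \<in> C" by (auto simp: C_def)
    then show "x \<in> \<Union>((\<lambda>A. A) ` C)" using dcell_self by blast
  next
    fix x assume "x \<in> \<Union>((\<lambda>A. A) ` C)"
    then obtain k y where "x \<in> dcell a r k y" "S k y" by (auto simp: C_def)
    then show "x \<in> {x. \<exists>k. S k x}" using cong by blast
  qed
  have sC: "A \<in> sets lebesgue" if "A \<in> C" for A
    using that r by (auto simp: C_def)
  show "{x. \<exists>k. S k x} \<in> sets lebesgue"
    unfolding U using cC sC by (intro sets.countable_UN') auto
  have D: "disjoint_family_on (\<lambda>A. A) C"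
    unfolding disjoint_family_on_def
  proof (intro ballI impI)
    fix A B assume A: "A \<in> C" and B: "B \<in> C" and "A \<noteq> B"
    obtain k x where kx: "A = dcell a r k x" "S k x" "\<forall>j<k. \<not> S j x" using A by (auto simp: C_def)
    obtain l y where ly: "B = dcell a r l y" "S l y" "\<forall>j<l. \<not> S j y" using B by (auto simp: C_def)
    show "A \<inter> B = {}"
    proof (rule ccontr)
      assume "A \<inter> B \<noteq> {}"
      then obtain z where z: "z \<in> dcell a r k x" "z \<in> dcell a r l y" using kx ly by auto
      \<comment> \<open>Up to generations \<open>k\<close> and \<open>l\<close>, stopping at the
        common point \<open>z\<close> agrees with stopping at \<open>x\<close> and at
        \<open>y\<close>. Hence \<open>k\<close> and \<open>l\<close> are both the first stopping
        time of \<open>z\<close>.\<close>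
      have zx: "S j z \<longleftrightarrow> S j x" if "j \<le> k" for j
        using dcell_mono_eq[OF that z(1)] cong dcell_self by metis
      have zy: "S j z \<longleftrightarrow> S j y" if "j \<le> l" for j
        using dcell_mono_eq[OF that z(2)] cong dcell_self by metis
      have "k = l"
        using zx zy kx ly by (metis linorder_neqE_nat order_refl less_imp_le)
      then show False using \<open>A \<noteq> B\<close> z kx ly dcell_eq by metis
    qed
  qed
  show "emeasure \<mu> {x. \<exists>k. S k x} \<le> emeasure \<nu> {x. \<exists>k. S k x}"
    if s: "sets \<mu> = sets lebesgue" "sets \<nu> = sets lebesgue"
    and le: "\<And>k x. S k x \<Longrightarrow> (\<forall>j<k. \<not> S j x) \<Longrightarrow> emeasure \<mu> (dcell a r k x) \<le> emeasure \<nu> (dcell a r k x)"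
  proof -
    have "emeasure \<mu> (\<Union>((\<lambda>A. A) ` C)) = (\<integral>\<^sup>+A. emeasure \<mu> A \<partial>count_space C)"
      using sC s by (intro emeasure_UN_countable[OF _ cC D]) auto
    also have "\<dots> \<le> (\<integral>\<^sup>+A. emeasure \<nu> A \<partial>count_space C)"
      using le by (intro nn_integral_mono) (auto simp: C_def)
    also have "\<dots> = emeasure \<nu> (\<Union>((\<lambda>A. A) ` C))"
      using sC s by (intro emeasure_UN_countable[OF _ cC D, symmetric]) auto
    finally show ?thesis unfolding U .
  qed
qed

section \<open>Outer regularity and one-sided dyadic differentiation\<close>

lemma outer_open_seq:
  fixes F :: "'a::euclidean_space set"
  assumes "F \<in> sets lebesgue"
  obtains V where "\<And>n::nat. open (V n)" "\<And>n. F \<subseteq> V n" "decseq V" "(\<Inter>n. V n) - F \<in> null_sets lebesgue"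
proof -
  \<comment> \<open>Regularity is used for Lebesgue measure only. Ending with a Lebesgue null set
    lets the approximation pass to every absolutely continuous measure.\<close>
  have "\<exists>T. open T \<and> F \<subseteq> T \<and> emeasure lebesgue (T - F) < ennreal (1 / Suc n)" for n :: nat
    by (metis sets_lebesgue_outer_open[OF assms] of_nat_0_less_iff zero_less_Suc zero_less_divide_1_iff)
  then obtain T where T: "\<And>n::nat. open (T n)" "\<And>n. F \<subseteq> T n"
    "\<And>n. emeasure lebesgue (T n - F) < ennreal (1 / Suc n)"
    by metis
  define V where "V n = (\<Inter>i\<le>n. T i)" for n
  have "open (V n)" "F \<subseteq> V n" for n using T by (auto simp: V_def)
  moreover have "decseq V" by (auto simp: V_def decseq_def)
  moreover have "(\<Inter>n. V n) - F \<in> null_sets lebesgue"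
  proof (rule null_setsI)
    have s: "T n - F \<in> sets lebesgue" for n
      using T(1)[of n] assms by (intro sets.Diff) auto
    have "emeasure lebesgue ((\<Inter>n. V n) - F) \<le> ennreal (1 / Suc n)" for n :: nat
    proof -
      have "emeasure lebesgue ((\<Inter>n. V n) - F) \<le> emeasure lebesgue (T n - F)"
        by (rule emeasure_mono[OF _ s]) (auto simp: V_def)
      with T(3)[of n] show ?thesis by order
    qed
    then have "emeasure lebesgue ((\<Inter>n. V n) - F) \<le> 0"
      using tendsto_ennrealI[OF lim_1_over_n[THEN LIMSEQ_Suc]]
      by (intro LIMSEQ_le_const[of "\<lambda>n. ennreal (1 / Suc n)"]) auto
    then show "emeasure lebesgue ((\<Inter>n. V n) - F) = 0" by simp
    have "(\<Inter>n. V n) - F = (\<Inter>n. T n - F)" by (auto simp: V_def)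
    also have "\<dots> \<in> sets lebesgue" using s by (intro sets.countable_INT) auto
    finally show "(\<Inter>n. V n) - F \<in> sets lebesgue" .
  qed
  ultimately show thesis using that by blast
qed

text \<open>A one-sided substitute for the Lebesgue differentiation theorem.\<close>

lemma dyadic_differentiation:
  fixes a :: "'a::euclidean_space"
  assumes r: "r > 0" and s: "sets \<mu> = sets lebesgue" "sets \<nu> = sets lebesgue"
    and ac: "absolutely_continuous lebesgue \<nu>"
    and fin: "emeasure \<nu> (dcell a r 0 a) \<noteq> \<infinity>"
    and F: "F \<in> sets lebesgue" "F \<subseteq> dcell a r 0 a"
    and le: "\<And>k x. x \<in> F \<Longrightarrow> emeasure \<mu> (dcell a r k x) \<le> emeasure \<nu> (dcell a r k x)"
  shows "emeasure \<mu> F \<le> emeasure \<nu> F"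
proof -
  obtain V where V: "\<And>n::nat. open (V n)" "\<And>n. F \<subseteq> V n" "decseq V"
    "(\<Inter>n. V n) - F \<in> null_sets lebesgue"
    using outer_open_seq[OF F(1)] by blast
  let ?Q = "dcell a r 0 a"
  have sV: "V n \<inter> ?Q \<in> sets lebesgue" for n
    using V(1)[of n] r by (intro sets.Int) auto
  have "emeasure \<mu> F \<le> emeasure \<nu> (V n \<inter> ?Q)" for n
  proof -
    \<comment> \<open>Every point of \<open>F\<close> stops at a small cell inside
      \<open>V n\<close>, so the comparison on cells bounds the \<open>\<mu>\<close>-measure of
      \<open>F\<close> by the \<open>\<nu>\<close>-measure of \<open>V n\<close> within the top
      cell.\<close>
    define S where "S k x \<longleftrightarrow> dcell a r k x \<subseteq> V n \<and> x \<in> ?Q \<and>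
      emeasure \<mu> (dcell a r k x) \<le> emeasure \<nu> (dcell a r k x)" for k x
    have cong: "S k y" if "y \<in> dcell a r k x" "S k x" for k x y
      using that dcell_eq[OF that(1)] dcell_mono_eq[OF _ that(1), of 0] dcell_eq dcell_self
      unfolding S_def by (metis le0)
    have "F \<subseteq> {x. \<exists>k. S k x}"
      using dcell_small[OF r V(1)[of n]] V(2)[of n] F(2) le unfolding S_def by blast
    then have "emeasure \<mu> F \<le> emeasure \<mu> {x. \<exists>k. S k x}"
      using stopped_sets[OF r, of a S] cong s by (intro emeasure_mono) auto
    also have "\<dots> \<le> emeasure \<nu> {x. \<exists>k. S k x}"
      by (rule stopped_le[OF r cong s]) (auto simp: S_def)
    also have "\<dots> \<le> emeasure \<nu> (V n \<inter> ?Q)"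
    proof (rule emeasure_mono)
      show "{x. \<exists>k. S k x} \<subseteq> V n \<inter> ?Q"
        using dcell_self by (fastforce simp: S_def)
    qed (use sV s in auto)
    finally show ?thesis .
  qed
  \<comment> \<open>Continuity from above needs \<open>\<nu>\<close> finite on the top cell. The
    intersection exceeds \<open>F\<close> only by a Lebesgue null set, which \<open>\<nu>\<close>
    ignores.\<close>
  then have "emeasure \<mu> F \<le> (INF n. emeasure \<nu> (V n \<inter> ?Q))"
    by (rule INF_greatest)
  also have "\<dots> = emeasure \<nu> (\<Inter>n. V n \<inter> ?Q)"
  proof (rule INF_emeasure_decseq)
    show "emeasure \<nu> (V n \<inter> ?Q) \<noteq> \<infinity>" for n
      using emeasure_mono[of "V n \<inter> ?Q" ?Q \<nu>] fin sets_dcell[OF r, of a 0 a] s(2) by (auto simp: top_unique)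
    show "decseq (\<lambda>n. V n \<inter> ?Q)" using V(3) by (auto simp: decseq_def)
  qed (use sV s in auto)
  also have "\<dots> \<le> emeasure \<nu> (F \<union> ((\<Inter>n. V n) - F))"
    using F V(4) s(2) by (intro emeasure_mono sets.Un) auto
  also have "\<dots> = emeasure \<nu> F"
    using F V(4) s(2) ac by (intro emeasure_Un_null_set) (auto simp: absolutely_continuous_def)
  finally show ?thesis .
qed

text \<open>With \<open>\<mu>\<close> the weighted measure and \<open>\<nu>\<close> a multiple of
  Lebesgue measure, this is a superlevel set of the local dyadic maximal function. With the roles
  exchanged, it is the set where some dyadic average of the weight drops below the level.\<close>

definition stop_set :: "'a::euclidean_space \<Rightarrow> real \<Rightarrow> 'a measure \<Rightarrow> 'a measure \<Rightarrow> 'a set" where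
  "stop_set a r \<mu> \<nu> =
    {x \<in> dcell a r 0 a. \<exists>k. emeasure \<nu> (dcell a r k x) < emeasure \<mu> (dcell a r k x)}"

lemma stop_set_cong:
  assumes "y \<in> dcell a r k x" "x \<in> dcell a r 0 a"
    "emeasure \<nu> (dcell a r k x) < emeasure \<mu> (dcell a r k x)"
  shows "y \<in> dcell a r 0 a \<and> emeasure \<nu> (dcell a r k y) < emeasure \<mu> (dcell a r k y)"
  using assms dcell_eq[OF assms(1)] dcell_antimono[of 0 k a r x] dcell_eq[OF assms(2)] by auto

lemma stop_set_alt:
  "stop_set a r \<mu> \<nu> = {x. \<exists>k. x \<in> dcell a r 0 a \<and> emeasure \<nu> (dcell a r k x) < emeasure \<mu> (dcell a r k x)}"
  by (auto simp: stop_set_def)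

lemma sets_stop_set [measurable]:
  assumes "r > 0" shows "stop_set a r \<mu> \<nu> \<in> sets lebesgue"
  unfolding stop_set_alt by (rule stopped_sets[OF assms]) (use stop_set_cong in blast)

text \<open>The first stopped cells partition the stop set, so two further measures need comparing
  only on them. There the reverse inequality at all earlier generations is available, in particular
  on the parent.\<close>

lemma stop_set_le:
  assumes r: "r > 0" and s: "sets \<mu>' = sets lebesgue" "sets \<nu>' = sets lebesgue"
    and le: "\<And>k x. x \<in> dcell a r 0 a \<Longrightarrow> emeasure \<nu> (dcell a r k x) < emeasure \<mu> (dcell a r k x) \<Longrightarrow>
      (\<And>j. j < k \<Longrightarrow> emeasure \<mu> (dcell a r j x) \<le> emeasure \<nu> (dcell a r j x)) \<Longrightarrow>
      emeasure \<mu>' (dcell a r k x) \<le> emeasure \<nu>' (dcell a r k x)"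
  shows "emeasure \<mu>' (stop_set a r \<mu> \<nu>) \<le> emeasure \<nu>' (stop_set a r \<mu> \<nu>)"
  unfolding stop_set_alt
  by (rule stopped_le[OF r _ s]) (use stop_set_cong in blast, auto intro!: le simp: not_less)

text \<open>A point outside the stop set satisfies the inequality on its cells of every generation,
  which is what dyadic differentiation asks for.\<close>

lemma off_stop_set_le:
  assumes "r > 0" "sets \<mu> = sets lebesgue" "sets \<nu> = sets lebesgue"
    and "absolutely_continuous lebesgue \<nu>" "emeasure \<nu> (dcell a r 0 a) \<noteq> \<infinity>"
    and "F \<in> sets lebesgue" "F \<subseteq> dcell a r 0 a" "F \<inter> stop_set a r \<mu> \<nu> = {}"
  shows "emeasure \<mu> F \<le> emeasure \<nu> F"
  using assms(7,8)
  by (intro dyadic_differentiation[OF assms(1-7)]) (fastforce simp: stop_set_def not_less[symmetric])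

lemma absolutely_continuous_scale: "absolutely_continuous M (scale_measure c M)"
  by (auto simp: absolutely_continuous_def null_sets_def)

section \<open>From the Fujii--Wilson constant to small sets\<close>

definition wmeas :: "('a::euclidean_space \<Rightarrow> real) \<Rightarrow> 'a measure" where
  "wmeas w = density lebesgue (\<lambda>x. ennreal (w x))"

lemma sets_wmeas [simp, measurable_cong]: "sets (wmeas w) = sets lebesgue"
  by (simp add: wmeas_def)

lemma weight_measurable: "weight w \<Longrightarrow> w \<in> borel_measurable lebesgue"
  by (simp add: weight_def)

lemma ac_wmeas: "weight w \<Longrightarrow> absolutely_continuous lebesgue (wmeas w)"
  unfolding wmeas_def
  by (intro absolutely_continuousI_density measurable_compose[OF weight_measurable measurable_ennreal])

lemma emeasure_wmeas:
  assumes "weight w" "A \<in> sets lebesgue"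
  shows "emeasure (wmeas w) A = (\<integral>\<^sup>+x\<in>A. ennreal (w x) \<partial>lebesgue)"
  unfolding wmeas_def using weight_measurable[OF assms(1)] assms(2)
  by (intro emeasure_density) auto

lemma wmeas_compact_finite:
  assumes "weight w" "compact K"
  shows "emeasure (wmeas w) K < \<infinity>"
proof -
  have "set_integrable lebesgue K w" using assms by (simp add: weight_def)
  then have "(\<integral>\<^sup>+x. ennreal (norm (indicator K x *\<^sub>R w x)) \<partial>lebesgue) < \<infinity>"
    by (simp add: set_integrable_def integrable_iff_bounded)
  also have "(\<integral>\<^sup>+x. ennreal (norm (indicator K x *\<^sub>R w x)) \<partial>lebesgue) =
      (\<integral>\<^sup>+x\<in>K. ennreal (w x) \<partial>lebesgue)"
    using assms(1) by (intro nn_integral_cong) (auto simp: weight_def indicator_def)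
  also have "\<dots> = emeasure (wmeas w) K"
    using assms by (intro emeasure_wmeas[symmetric] lmeasurable_compact fmeasurableD) auto
  finally show ?thesis .
qed

lemma wmeas_dcell:
  "weight w \<Longrightarrow> r > 0 \<Longrightarrow> emeasure (wmeas w) (dcell a r k x) = emeasure (wmeas w) (dcube a r k x)"
  by (rule emeasure_dcell_eq_dcube) (auto simp: ac_wmeas)

lemma wmeas_cube_finite: "weight w \<Longrightarrow> cube Q \<Longrightarrow> emeasure (wmeas w) Q < \<infinity>"
  by (rule wmeas_compact_finite) (auto simp: cube_def)

lemma wmeas_dcell_finite: "weight w \<Longrightarrow> r > 0 \<Longrightarrow> emeasure (wmeas w) (dcell a r k x) < \<infinity>"
  by (simp only: wmeas_dcell wmeas_cube_finite cube_dcube)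

lemma sets_cube: "cube Q \<Longrightarrow> Q \<in> sets lebesgue"
  by (auto simp: cube_def)

lemma Ainf_const_bound:
  assumes w: "weight w" and A: "Ainf_const w \<le> A" and Q: "cube Q"
    and pos: "emeasure (wmeas w) Q \<noteq> 0"
  shows "(\<integral>\<^sup>+x\<in>Q. maxop (\<lambda>y. ennreal (w y) * indicator Q y) x \<partial>lebesgue) \<le> A * emeasure (wmeas w) Q"
proof -
  let ?I = "\<integral>\<^sup>+x\<in>Q. maxop (\<lambda>y. ennreal (w y) * indicator Q y) x \<partial>lebesgue"
  let ?v = "emeasure (wmeas w) Q"
  have "?I / ?v \<le> Ainf_const w"
    unfolding Ainf_const_def emeasure_wmeas[OF w sets_cube[OF Q]]
    by (rule SUP_upper2[of Q]) (use Q in auto)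
  also note A
  finally have "?I / ?v * ?v \<le> A * ?v" by (rule mult_right_mono) simp
  moreover have "?I / ?v * ?v = ?I"
    using pos wmeas_cube_finite[OF w Q] by (simp add: ennreal_divide_times)
  ultimately show ?thesis by simp
qed

text \<open>The closed dyadic cube at which \<open>x\<close> stops is a competitor in the uncentered
  supremum. It lies in the top cube, so truncating \<open>w\<close> leaves its average
  unchanged.\<close>

lemma stop_set_maxop:
  fixes a :: "'a::euclidean_space"
  assumes w: "weight w" and r: "r > 0"
    and x: "x \<in> stop_set a r (wmeas w) (scale_measure t lebesgue)"
  shows "t \<le> maxop (\<lambda>y. ennreal (w y) * indicator (cbox a (a + r *\<^sub>R One)) y) x"
proof -
  let ?Q = "cbox a (a + r *\<^sub>R One)"
  obtain k where k: "x \<in> dcell a r 0 a" "t * emeasure lebesgue (dcell a r k x) < emeasure (wmeas w) (dcell a r k x)"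
    using x by (auto simp: stop_set_def)
  let ?P = "dcube a r k x"
  have P: "cube ?P" by (rule cube_dcube[OF r])
  have PQ: "?P \<subseteq> ?Q"
    using dcube_antimono[OF r, of 0 k a x] dcube_eq[OF k(1)] dcube_0[OF r, of a] by simp
  have "emeasure lebesgue (dcell a r k x) = emeasure lebesgue ?P"
    by (rule emeasure_dcell_eq_dcube[OF r]) (auto simp: absolutely_continuous_def)
  with k(2) have lt: "t * emeasure lebesgue ?P < emeasure (wmeas w) ?P"
    by (simp add: wmeas_dcell[OF w r])
  have e: "emeasure lebesgue ?P = ennreal ((r / 2 ^ k) ^ DIM('a))"
    unfolding dcube_def using r by (subst emeasure_lebesgue_cube) auto
  have "avg (\<lambda>y. ennreal (w y) * indicator ?Q y) ?P = emeasure (wmeas w) ?P / emeasure lebesgue ?P"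
  proof -
    have "(\<integral>\<^sup>+y\<in>?P. ennreal (w y) * indicator ?Q y \<partial>lebesgue) = (\<integral>\<^sup>+y\<in>?P. ennreal (w y) \<partial>lebesgue)"
      using PQ by (intro nn_integral_cong) (auto simp: indicator_def)
    then show ?thesis by (simp add: avg_def emeasure_wmeas[OF w sets_cube[OF P]])
  qed
  moreover have "t \<le> emeasure (wmeas w) ?P / emeasure lebesgue ?P"
  proof -
    have "t * emeasure lebesgue ?P / emeasure lebesgue ?P \<le> emeasure (wmeas w) ?P / emeasure lebesgue ?P"
      using lt by (intro divide_right_mono_ennreal) auto
    moreover have "t * emeasure lebesgue ?P / emeasure lebesgue ?P = t"
      using r by (simp add: e ennreal_times_divide[symmetric] ennreal_divide_self)
    ultimately show ?thesis by simp
  qed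
  moreover have "avg (\<lambda>y. ennreal (w y) * indicator ?Q y) ?P \<le> maxop (\<lambda>y. ennreal (w y) * indicator ?Q y) x"
    unfolding maxop_def using P dcell_subset_dcube[OF r, of a k x] dcell_self
    by (intro SUP_upper) blast
  ultimately show ?thesis by order
qed

lemma emeasure_dcell_Suc:
  fixes a :: "'a::euclidean_space"
  assumes "r > 0"
  shows "emeasure lebesgue (dcell a r k x) = 2 ^ DIM('a) * emeasure lebesgue (dcell a r (Suc k) x)"
proof -
  have "(r / 2 ^ k) ^ DIM('a) = 2 ^ DIM('a) * (r / 2 ^ Suc k) ^ DIM('a)"
    by (simp flip: power_mult_distrib)
  then show ?thesis
    unfolding emeasure_lebesgue_dcell[OF assms] using assms
    by (simp add: ennreal_mult ennreal_power flip: ennreal_numeral)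
qed

text \<open>The parent of a first stopped cell is not stopped, which bounds the average
  over the cell itself up to the factor \<open>2 ^ DIM('a)\<close>.\<close>

lemma stop_set_upper:
  fixes a :: "'a::euclidean_space"
  assumes w: "weight w" and r: "r > 0"
    and t: "emeasure (wmeas w) (dcell a r 0 a) \<le> t * emeasure lebesgue (dcell a r 0 a)"
  defines "X \<equiv> stop_set a r (wmeas w) (scale_measure t lebesgue)"
  shows "emeasure (wmeas w) X \<le> 2 ^ DIM('a) * t * emeasure lebesgue X"
proof -
  have "emeasure (wmeas w) X \<le> emeasure (scale_measure (2 ^ DIM('a) * t) lebesgue) X"
    unfolding X_def
  proof (rule stop_set_le[OF r])
    fix k x assume x: "x \<in> dcell a r 0 a"
      and k: "emeasure (scale_measure t lebesgue) (dcell a r k x) < emeasure (wmeas w) (dcell a r k x)"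
      and j: "\<And>j. j < k \<Longrightarrow> emeasure (wmeas w) (dcell a r j x) \<le> emeasure (scale_measure t lebesgue) (dcell a r j x)"
    \<comment> \<open>By \<open>t\<close> the top cell is not stopped, so a stopped cell has a
      parent to compare with.\<close>
    have "k \<noteq> 0" using k t dcell_eq[OF x] by (metis emeasure_scale_measure not_less)
    then obtain i where i: "k = Suc i" by (cases k) auto
    have "emeasure (wmeas w) (dcell a r k x) \<le> emeasure (wmeas w) (dcell a r i x)"
      using dcell_Suc_subset[of a r i x] r unfolding i by (intro emeasure_mono) auto
    also have "\<dots> \<le> t * emeasure lebesgue (dcell a r i x)" using j[of i] i by simp
    also have "\<dots> = 2 ^ DIM('a) * t * emeasure lebesgue (dcell a r k x)"
      unfolding i by (subst emeasure_dcell_Suc[OF r]) (simp add: mult_ac)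
    finally show "emeasure (wmeas w) (dcell a r k x) \<le> emeasure (scale_measure (2 ^ DIM('a) * t) lebesgue) (dcell a r k x)"
      by simp
  qed auto
  then show ?thesis by simp
qed

lemma wmeas_Int_dcell:
  assumes w: "weight w" and r: "r > 0" and E: "E \<in> sets lebesgue" "E \<subseteq> dcube a r k x"
  shows "emeasure (wmeas w) E = emeasure (wmeas w) (E \<inter> dcell a r k x)"
proof -
  have n: "dcube a r k x - dcell a r k x \<in> null_sets (wmeas w)"
    using dcube_diff_dcell_null[OF r] ac_wmeas[OF w] by (auto simp: absolutely_continuous_def)
  have "emeasure (wmeas w) ((E \<inter> dcell a r k x) \<union> (dcube a r k x - dcell a r k x)) = emeasure (wmeas w) (E \<inter> dcell a r k x)"
    using E r n by (intro emeasure_Un_null_set) auto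
  moreover have "emeasure (wmeas w) E \<le> emeasure (wmeas w) ((E \<inter> dcell a r k x) \<union> (dcube a r k x - dcell a r k x))"
    using E r n by (intro emeasure_mono sets.Un) auto
  moreover have "emeasure (wmeas w) (E \<inter> dcell a r k x) \<le> emeasure (wmeas w) E"
    using E r by (intro emeasure_mono) auto
  ultimately show ?thesis by order
qed

text \<open>The coefficients up to the highest level whose set contains \<open>x\<close> form a
  geometric series dominated by its last term, up to a factor 2. Halving the coefficients absorbs
  that factor.\<close>

lemma sum_dyadic_levels_le:
  fixes M :: ennreal
  assumes "s \<ge> 0" "\<And>j. j < m \<Longrightarrow> x \<in> X j \<Longrightarrow> ennreal (2 ^ j * s) \<le> M"
  shows "(\<Sum>j<m. ennreal (2 ^ j * s / 2) * indicator (X j) x) \<le> M"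
  using assms(2)
proof (induction m)
  case (Suc m)
  show ?case
  proof (cases "x \<in> X m")
    case False
    then show ?thesis using Suc by simp
  next
    case True
    have "(\<Sum>j<Suc m. ennreal (2 ^ j * s / 2) * indicator (X j) x) \<le> (\<Sum>j<Suc m. ennreal (2 ^ j * s / 2))"
      by (intro sum_mono) (auto simp: indicator_def)
    also have "\<dots> = ennreal (\<Sum>j<Suc m. 2 ^ j * s / 2)"
      using assms(1) by (intro sum_ennreal) auto
    also have "(\<Sum>j<Suc m. 2 ^ j * s / 2) = (2 ^ Suc m - 1) * s / 2"
      by (induction m) (simp_all add: field_simps)
    also have "\<dots> \<le> 2 ^ m * s" using assms(1) by (simp add: algebra_simps)
    also have "ennreal (2 ^ m * s) \<le> M" using Suc.prems[of m] True by simp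
    finally show ?thesis by (simp add: ennreal_leI)
  qed
qed simp

text \<open>A quantitative absolute continuity of the weighted measure. Both the doubling estimate
  and the decay of the low level sets draw on the Fujii--Wilson condition through this
  property.\<close>

definition small_set_cond :: "real \<Rightarrow> ('a::euclidean_space \<Rightarrow> real) \<Rightarrow> bool" where
  "small_set_cond \<eta> w \<longleftrightarrow> (\<forall>Q E. cube Q \<longrightarrow> E \<in> sets lebesgue \<longrightarrow> E \<subseteq> Q \<longrightarrow>
    emeasure lebesgue E \<le> ennreal \<eta> * emeasure lebesgue Q \<longrightarrow>
    2 * emeasure (wmeas w) E \<le> emeasure (wmeas w) Q)"

lemma small_set_condD:
  "small_set_cond \<eta> w \<Longrightarrow> cube Q \<Longrightarrow> E \<in> sets lebesgue \<Longrightarrow> E \<subseteq> Q \<Longrightarrow>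
    emeasure lebesgue E \<le> ennreal \<eta> * emeasure lebesgue Q \<Longrightarrow>
    2 * emeasure (wmeas w) E \<le> emeasure (wmeas w) Q"
  unfolding small_set_cond_def by blast

text \<open>Each of the \<open>m\<close> levels contributes at least \<open>u / 2 ^ (n + 1)\<close>
  to a sum bounded by \<open>A * v\<close>, where \<open>u\<close> and \<open>v\<close> are the
  masses of \<open>X m\<close> and \<open>Q\<close>; this forces \<open>u \<le> v / 4\<close>. The
  extra 2 in the exponent \<open>m + 2\<close> bounds the mass of \<open>E\<close> off
  \<open>X m\<close> by another \<open>v / 4\<close>.\<close>

lemma Ainf_small_set_cond:
  fixes w :: "'a::euclidean_space \<Rightarrow> real"
  assumes w: "weight w" and A: "Ainf_const w \<le> ennreal A" "A > 0"
    and m: "2 ^ (DIM('a) + 3) * A \<le> real m"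
  shows "small_set_cond (1 / 2 ^ (m + 2)) w"
  unfolding small_set_cond_def
proof (intro allI impI)
  fix Q E :: "'a set"
  assume Q: "cube Q" and E: "E \<in> sets lebesgue" "E \<subseteq> Q"
    and le: "emeasure lebesgue E \<le> ennreal (1 / 2 ^ (m + 2)) * emeasure lebesgue Q"
  show "2 * emeasure (wmeas w) E \<le> emeasure (wmeas w) Q"
  proof (cases "emeasure (wmeas w) Q = 0")
    case True
    have "emeasure (wmeas w) E \<le> emeasure (wmeas w) Q"
      using E Q sets_cube by (intro emeasure_mono) auto
    with True show ?thesis by simp
  next
    case False
    let ?W = "emeasure (wmeas w)" and ?L = "emeasure lebesgue"
    let ?n = "DIM('a)"
    obtain a r where r: "r > 0" and Qa: "Q = cbox a (a + r *\<^sub>R One)"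
      using Q by (auto simp: cube_def)
    have Qd: "Q = dcube a r 0 a" by (simp add: Qa dcube_0[OF r])
    let ?D = "dcell a r 0 a"
    have LQ: "?L ?D = ennreal (r ^ ?n)" "?L Q = ennreal (r ^ ?n)"
      using r emeasure_lebesgue_dcell[OF r, of a 0 a] by (simp_all only: Qa emeasure_lebesgue_cube less_imp_le) simp
    have WD: "?W ?D = ?W Q" using wmeas_dcell[OF w r, of a 0 a] Qd by simp
    define v where "v = measure (wmeas w) Q"
    have v: "?W Q = ennreal v"
      using wmeas_cube_finite[OF w Q] by (simp add: v_def emeasure_eq_ennreal_measure)
    have v0: "v > 0" using False v by (simp add: v_def zero_less_measure_iff)
    define s where "s = v / r ^ ?n"
    have s0: "s > 0" and sv: "s * r ^ ?n = v" using r v0 by (auto simp: s_def)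
    define t where "t j = 2 ^ j * s" for j :: nat
    have t0: "t j > 0" for j using s0 by (simp add: t_def)
    define X where "X j = stop_set a r (wmeas w) (scale_measure (ennreal (t j)) lebesgue)" for j
    have sX: "X j \<in> sets lebesgue" for j unfolding X_def by (rule sets_stop_set[OF r])
    have XD: "X j \<subseteq> ?D" for j by (auto simp: X_def stop_set_def)
    have XQ: "X j \<subseteq> Q" for j using XD dcell_subset_dcube[OF r] Qd by blast
    have Xmono: "X m \<subseteq> X j" if "j \<le> m" for j
    proof -
      have "t j \<le> t m" using that s0 by (simp add: t_def)
      then have "ennreal (t j) * c \<le> ennreal (t m) * c" for c by (intro mult_right_mono ennreal_leI) auto
      then show ?thesis unfolding X_def stop_set_def by (auto intro: le_less_trans)
    qed
    have avg: "?W ?D \<le> ennreal (t j) * ?L ?D" for j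
    proof -
      have "v \<le> t j * r ^ ?n"
        using v0 mult_right_mono[of 1 "2 ^ j" "s * r ^ ?n"] by (simp add: t_def sv mult.assoc)
      then show ?thesis using t0[of j] r by (simp add: WD v LQ ennreal_leI flip: ennreal_mult)
    qed
    define o' where "o' j = measure lebesgue (X j)" for j
    have o': "?L (X j) = ennreal (o' j)" for j
      unfolding o'_def
    proof (rule emeasure_eq_ennreal_measure)
      have "?L (X j) \<le> ?L Q" by (rule emeasure_mono[OF XQ sets_cube[OF Q]])
      then show "?L (X j) \<noteq> top" by (auto simp: LQ top_unique)
    qed
    have o'0: "o' j \<ge> 0" for j by (simp add: o'_def)
    define u where "u = measure (wmeas w) (X m)"
    have u: "?W (X m) = ennreal u"
      unfolding u_def
    proof (rule emeasure_eq_ennreal_measure)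
      have "?W (X m) \<le> ?W Q" by (rule emeasure_mono[OF XQ]) (use sets_cube[OF Q] in simp)
      then show "?W (X m) \<noteq> top" by (auto simp: v top_unique)
    qed
    have u0: "u \<ge> 0" by (simp add: u_def)
    \<comment> \<open>Nestedness transfers the mass of \<open>X m\<close> to every lower level,
      where the parent bound applies.\<close>
    have 1: "u \<le> 2 ^ ?n * t j * o' j" if "j < m" for j
    proof -
      have "?W (X m) \<le> ?W (X j)" using Xmono[of j] that sX by (intro emeasure_mono) auto
      also have "\<dots> \<le> 2 ^ ?n * ennreal (t j) * ?L (X j)"
        unfolding X_def by (rule stop_set_upper[OF w r avg])
      also have "\<dots> = ennreal (2 ^ ?n * t j * o' j)"
        unfolding o' using t0[of j] o'0[of j] by (simp add: ennreal_mult ennreal_power flip: ennreal_numeral)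
      finally show ?thesis using t0[of j] o'0[of j] by (simp add: u ennreal_le_iff)
    qed
    \<comment> \<open>The pointwise bound of the levels by the maximal function is integrated over
      \<open>Q\<close>.\<close>
    have 2: "(\<Sum>j<m. t j / 2 * o' j) \<le> A * v"
    proof -
      let ?M = "maxop (\<lambda>y. ennreal (w y) * indicator Q y)"
      have "(\<Sum>j<m. ennreal (2 ^ j * s / 2) * indicator (X j) x) \<le> ?M x * indicator Q x" for x
      proof (rule sum_dyadic_levels_le)
        show "ennreal (2 ^ j * s) \<le> ?M x * indicator Q x" if "x \<in> X j" for j
          using stop_set_maxop[OF w r, of x a "ennreal (t j)"] that XQ[of j]
          by (auto simp: X_def t_def Qa)
      qed (use s0 in simp)
      then have "(\<integral>\<^sup>+x. (\<Sum>j<m. ennreal (t j / 2) * indicator (X j) x) \<partial>lebesgue) \<le> (\<integral>\<^sup>+x\<in>Q. ?M x \<partial>lebesgue)"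
        by (intro nn_integral_mono) (simp add: t_def)
      also have "\<dots> \<le> ennreal A * ?W Q" by (rule Ainf_const_bound[OF w A(1) Q False])
      also have "\<dots> = ennreal (A * v)" using A(2) v0 by (simp add: v ennreal_mult)
      also have "(\<integral>\<^sup>+x. (\<Sum>j<m. ennreal (t j / 2) * indicator (X j) x) \<partial>lebesgue) = (\<Sum>j<m. ennreal (t j / 2) * ?L (X j))"
        using sX by (subst nn_integral_sum) (auto simp: nn_integral_cmult_indicator)
      also have "\<dots> = ennreal (\<Sum>j<m. t j / 2 * o' j)"
      proof -
        have "ennreal (t j / 2) * ?L (X j) = ennreal (t j / 2 * o' j)" for j
          unfolding o' using t0[of j] o'0[of j] by (intro ennreal_mult[symmetric]) auto
        then show ?thesis using t0 o'0 by (simp add: less_imp_le)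
      qed
      finally show ?thesis using A(2) v0 by (simp add: ennreal_le_iff)
    qed
    have "u / 2 ^ (?n + 1) \<le> t j / 2 * o' j" if "j < m" for j
      using 1[OF that] by (simp add: field_simps)
    then have "(\<Sum>j<m. u / 2 ^ (?n + 1)) \<le> (\<Sum>j<m. t j / 2 * o' j)" by (intro sum_mono) auto
    with 2 have "real m * (u / 2 ^ (?n + 1)) \<le> A * v" by simp
    moreover have "2 ^ (?n + 3) * A * (u / 2 ^ (?n + 1)) \<le> real m * (u / 2 ^ (?n + 1))"
      using m u0 by (intro mult_right_mono) auto
    moreover have "2 ^ (?n + 3) * A * (u / 2 ^ (?n + 1)) = A * (4 * u)" by (simp add: field_simps power_add)
    ultimately have "A * (4 * u) \<le> A * v" by linarith
    then have u4: "4 * u \<le> v" using A(2) by simp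
    have "?W E = ?W (E \<inter> ?D)"
      using wmeas_Int_dcell[OF w r E(1)] E(2) Qd by blast
    also have "\<dots> \<le> ?W (X m \<union> (E \<inter> ?D - X m))"
      using E sX r by (intro emeasure_mono) auto
    also have "\<dots> \<le> ?W (X m) + ?W (E \<inter> ?D - X m)"
      using E sX r by (intro emeasure_subadditive) auto
    \<comment> \<open>Off \<open>X m\<close> all dyadic averages are at most \<open>t m\<close>, so
      differentiation bounds the mass by \<open>t m\<close> times Lebesgue measure.\<close>
    also have "?W (E \<inter> ?D - X m) \<le> emeasure (scale_measure (ennreal (t m)) lebesgue) (E \<inter> ?D - X m)"
      by (rule off_stop_set_le[OF r, where a = a])
         (use E sX r LQ in \<open>auto simp: X_def absolutely_continuous_scale ennreal_mult_eq_top_iff\<close>)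
    also have "\<dots> \<le> ennreal (t m) * ?L E"
      using E sX r by (simp del: emeasure_completion) (intro mult_left_mono emeasure_mono, auto)
    also have "\<dots> \<le> ennreal (t m) * (ennreal (1 / 2 ^ (m + 2)) * ?L Q)"
      by (intro mult_left_mono le) simp
    also have "\<dots> = ennreal (t m * (1 / 2 ^ (m + 2) * r ^ ?n))"
    proof -
      have "0 \<le> t m" "0 \<le> 1 / (2::real) ^ (m + 2)" "0 \<le> r ^ ?n" using t0[of m] r by auto
      then show ?thesis by (simp only: LQ ennreal_mult mult_nonneg_nonneg)
    qed
    also have "t m * (1 / 2 ^ (m + 2) * r ^ ?n) = v / 4"
      by (simp add: t_def sv[symmetric])
    also have "?W (X m) + ennreal (v / 4) = ennreal (u + v / 4)"
      using u0 v0 by (simp add: u)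
    finally have "?W E \<le> ennreal (u + v / 4)" by (simp add: add_left_mono)
    also have "\<dots> \<le> ennreal (v / 2)" using u4 by (intro ennreal_leI) simp
    finally have "2 * ?W E \<le> 2 * ennreal (v / 2)" by (rule mult_left_mono) simp
    also have "\<dots> = ?W Q" using v0 by (simp add: v ennreal_mult[symmetric] flip: ennreal_numeral)
    finally show ?thesis .
  qed
qed

section \<open>Doubling\<close>

text \<open>Passing to a slightly larger cube at most doubles the mass; the smaller cube is
  reached after \<open>j\<close> such steps.\<close>

lemma doubling_from_small_sets:
  fixes a b :: "'a::euclidean_space"
  assumes sm: "small_set_cond \<eta> w"
    and w: "weight w" and J: "J \<ge> 1" "real DIM('a) \<le> real J * \<eta>"
    and rho: "\<rho> > 0" "(1 - 1 / real J) ^ j * r \<le> \<rho>"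
    and sub: "cbox b (b + \<rho> *\<^sub>R One) \<subseteq> cbox a (a + r *\<^sub>R One)"
  shows "emeasure (wmeas w) (cbox a (a + r *\<^sub>R One)) \<le> 2 ^ j * emeasure (wmeas w) (cbox b (b + \<rho> *\<^sub>R One))"
  using rho(2) sub
proof (induction j arbitrary: a r)
  case (0 a r)
  \<comment> \<open>With no steps left \<open>r \<le> \<rho>\<close>, so containment forces the two
    cubes to coincide.\<close>
  have c: "a \<bullet> i \<le> b \<bullet> i \<and> b \<bullet> i + \<rho> \<le> a \<bullet> i + r" if "i \<in> Basis" for i
    using 0(2) rho(1) that by (subst (asm) subset_box) (auto simp: inner_add_left)
  obtain i :: 'a where "i \<in> Basis" using nonempty_Basis by blast
  then have "r = \<rho>" using c[of i] 0(1) by simp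
  moreover have "a = b"
    unfolding euclidean_eq_iff[of a b] using c 0(1) by (auto intro!: antisym) (smt (verit) c)
  ultimately show ?case by simp
next
  case (Suc j a r)
  let ?W = "emeasure (wmeas w)" and ?n = "DIM('a)"
  define q where "q = 1 - 1 / real J"
  have q: "0 \<le> q" "q \<le> 1" using J by (auto simp: q_def)
  have c: "a \<bullet> i \<le> b \<bullet> i \<and> b \<bullet> i + \<rho> \<le> a \<bullet> i + r" if "i \<in> Basis" for i
    using Suc.prems(2) rho(1) that by (subst (asm) subset_box) (auto simp: inner_add_left)
  obtain i :: 'a where "i \<in> Basis" using nonempty_Basis by blast
  then have rr: "\<rho> \<le> r" using c[of i] by simp
  \<comment> \<open>One step shrinks the side by the factor \<open>q\<close>, but never below the
    target side \<open>\<rho>\<close>.\<close>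
  define \<sigma> where "\<sigma> = max \<rho> (q * r)"
  have qr: "q * r \<le> r" using q rr rho(1) mult_right_mono[of q 1 r] by simp
  have \<sigma>: "\<rho> \<le> \<sigma>" "\<sigma> \<le> r" "\<sigma> > 0" "q * r \<le> \<sigma>" using rr rho(1) qr by (auto simp: \<sigma>_def)
  \<comment> \<open>The corner is the lowest one that stays in \<open>?Q\<close> and still lets a
    cube of side \<open>\<sigma>\<close> reach the upper faces of \<open>?P\<close>.\<close>
  define c' where "c' = (\<Sum>i\<in>Basis. max (a \<bullet> i) (b \<bullet> i + \<rho> - \<sigma>) *\<^sub>R i)"
  have c': "c' \<bullet> i = max (a \<bullet> i) (b \<bullet> i + \<rho> - \<sigma>)" if "i \<in> Basis" for i
    using that by (simp add: c'_def)
  let ?P = "cbox b (b + \<rho> *\<^sub>R One)" and ?R = "cbox c' (c' + \<sigma> *\<^sub>R One)" and ?Q = "cbox a (a + r *\<^sub>R One)"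
  have PR: "?P \<subseteq> ?R"
    using c \<sigma> by (subst subset_box) (auto simp: inner_add_left c')
  have RQ: "?R \<subseteq> ?Q"
    using c \<sigma> by (subst subset_box) (fastforce simp: inner_add_left c')
  have "q ^ j * \<sigma> \<le> \<rho>"
  proof (cases "\<rho> \<le> q * r")
    case True
    then show ?thesis using Suc.prems(1) by (simp add: \<sigma>_def q_def mult_ac)
  next
    case False
    then have "\<sigma> = \<rho>" by (simp add: \<sigma>_def)
    then show ?thesis using q rho(1) mult_right_mono[of "q ^ j" 1 \<rho>] by (simp add: power_le_one)
  qed
  then have IH: "?W ?R \<le> 2 ^ j * ?W ?P" using Suc.IH[OF _ PR] by (simp add: q_def)
  have "r > 0" using rr rho by simp
  then have Q: "cube ?Q" by (auto simp: cube_def)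
  have L: "emeasure lebesgue (?Q - ?R) \<le> ennreal \<eta> * emeasure lebesgue ?Q"
  proof -
    have "emeasure lebesgue (?Q - ?R) = emeasure lebesgue ?Q - emeasure lebesgue ?R"
      using RQ \<sigma>(3) by (intro emeasure_Diff) (auto simp: emeasure_lebesgue_cube simp del: emeasure_completion)
    also have "\<dots> = ennreal (r ^ ?n) - ennreal (\<sigma> ^ ?n)"
      using \<sigma>(3) \<open>r > 0\<close> by (simp only: emeasure_lebesgue_cube less_imp_le)
    also have "\<dots> = ennreal (r ^ ?n - \<sigma> ^ ?n)"
      using \<sigma>(3) by (simp add: ennreal_minus)
    also have "\<dots> \<le> ennreal (\<eta> * r ^ ?n)"
    proof (rule ennreal_leI)
      \<comment> \<open>Bernoulli's inequality keeps at least the fraction \<open>1 - n / J\<close>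
        of the volume, and \<open>n / J \<le> \<eta>\<close>.\<close>
      have "1 + real ?n * (- 1 / real J) \<le> (1 + (- 1 / real J)) ^ ?n"
        using J by (intro Bernoulli_inequality) auto
      then have "1 - real ?n / real J \<le> q ^ ?n" by (simp add: q_def)
      moreover have "real ?n / real J \<le> \<eta>" using J by (simp add: field_simps)
      ultimately have "1 - \<eta> \<le> q ^ ?n" by linarith
      then have "(1 - \<eta>) * r ^ ?n \<le> (q * r) ^ ?n"
        unfolding power_mult_distrib using \<open>r > 0\<close> by (intro mult_right_mono) auto
      also have "\<dots> \<le> \<sigma> ^ ?n" using \<sigma> q \<open>r > 0\<close> by (intro power_mono) auto
      finally show "r ^ ?n - \<sigma> ^ ?n \<le> \<eta> * r ^ ?n" by (simp add: algebra_simps)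
    qed
    also have "\<dots> = ennreal \<eta> * emeasure lebesgue ?Q"
    proof -
      have "0 < real DIM('a)" by simp
      with J(2) have "0 < real J * \<eta>" by linarith
      then have "0 \<le> \<eta>" by (simp add: zero_less_mult_iff)
      then show ?thesis using \<open>r > 0\<close> by (simp only: emeasure_lebesgue_cube less_imp_le ennreal_mult zero_le_power)
    qed
    finally show ?thesis .
  qed
  have d: "2 * ?W (?Q - ?R) \<le> ?W ?Q" by (rule small_set_condD[OF sm Q _ _ L]) auto
  have e: "?W ?Q = ?W ?R + ?W (?Q - ?R)"
    using RQ by (subst plus_emeasure) (auto intro!: arg_cong[where f = ?W])
  have "?W ?Q \<le> 2 * ?W ?R"
  proof -
    \<comment> \<open>At most half of the mass lies in the removed part, hence at least half in
      \<open>?R\<close>; the cancellation needs the removed mass to be finite.\<close>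
    have "?W (?Q - ?R) \<noteq> top" using e wmeas_cube_finite[OF w Q] by auto
    moreover have "?W (?Q - ?R) + ?W (?Q - ?R) \<le> ?W (?Q - ?R) + ?W ?R"
      using d e by (simp add: mult_2 add.commute)
    ultimately have "?W (?Q - ?R) \<le> ?W ?R" by (simp add: ennreal_add_left_cancel_le)
    then show ?thesis by (simp add: e mult_2)
  qed
  also have "\<dots> \<le> 2 * (2 ^ j * ?W ?P)" by (intro mult_left_mono IH) simp
  finally show ?case by (simp add: mult_ac)
qed

text \<open>Since \<open>(1 - 1 / J) ^ J\<close> is at most \<open>exp (- 1)\<close>, hence at most
  one half, \<open>J\<close> shrinking steps lead from a cell to a child.\<close>

lemma dyadic_doubling:
  fixes a :: "'a::euclidean_space"
  assumes sm: "small_set_cond \<eta> w"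
    and w: "weight w" and J: "J \<ge> 1" "real DIM('a) \<le> real J * \<eta>" and r: "r > 0"
  shows "emeasure (wmeas w) (dcell a r k x) \<le> 2 ^ J * emeasure (wmeas w) (dcell a r (Suc k) x)"
proof -
  have "(1 - 1 / real J) ^ J \<le> exp (- 1 / real J) ^ J"
    using exp_ge_add_one_self[of "- 1 / real J"] J by (intro power_mono) auto
  also have "\<dots> = exp (- 1)" using J by (simp flip: exp_of_nat_mult)
  also have "\<dots> \<le> 1 / 2" using exp_ge_add_one_self[of 1] by (simp add: exp_minus field_simps)
  finally have "(1 - 1 / real J) ^ J * (r / 2 ^ k) \<le> 1 / 2 * (r / 2 ^ k)"
    using r by (intro mult_right_mono) auto
  then have "(1 - 1 / real J) ^ J * (r / 2 ^ k) \<le> r / 2 ^ Suc k" by simp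
  then show ?thesis
    unfolding wmeas_dcell[OF w r] unfolding dcube_def
    using dcube_Suc_subset[OF r, of a k x] r
    by (intro doubling_from_small_sets[OF sm w J]) (auto simp: dcube_def)
qed

section \<open>Negative powers of the weight\<close>

text \<open>Let \<open>C\<close> be a first stopped cell for \<open>\<tau>\<close> and
  \<open>Y\<close> the stop set for \<open>\<tau> / (4 * B)\<close>. The unstopped parent and
  doubling give \<open>C\<close> average at least \<open>\<tau> / B\<close>, so \<open>Y\<close>
  holds at most a quarter of the mass of \<open>C\<close>. If \<open>C - Y\<close> had relative
  measure at most \<open>\<eta>\<close>, it would hold at most half, which leaves mass unaccounted
  for.\<close>

lemma stop_set_decay:
  fixes a :: "'a::euclidean_space"
  assumes sm: "small_set_cond \<eta> w"
    and w: "weight w" and r: "r > 0" and eta: "0 \<le> \<eta>" "\<eta> \<le> 1" and B: "B \<ge> 1"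
    and dbl: "\<And>k x. emeasure (wmeas w) (dcell a r k x) \<le> ennreal B * emeasure (wmeas w) (dcell a r (Suc k) x)"
    and tau: "\<tau> > 0" "ennreal \<tau> * emeasure lebesgue (dcell a r 0 a) \<le> emeasure (wmeas w) (dcell a r 0 a)"
  defines "X \<equiv> \<lambda>t. stop_set a r (scale_measure (ennreal t) lebesgue) (wmeas w)"
  shows "emeasure lebesgue (X (\<tau> / (4 * B))) \<le> ennreal (1 - \<eta>) * emeasure lebesgue (X \<tau>)"
proof -
  let ?W = "emeasure (wmeas w)" and ?L = "emeasure lebesgue"
  define \<tau>' where "\<tau>' = \<tau> / (4 * B)"
  have tau': "0 < \<tau>'" "\<tau>' \<le> \<tau>"
    using tau B mult_left_mono[of 1 "4 * B" \<tau>] by (auto simp: \<tau>'_def field_simps)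
  have le: "ennreal \<tau>' * z \<le> ennreal \<tau> * z" for z
    using tau' by (intro mult_right_mono ennreal_leI) auto
  have X_eq: "X t = stop_set a r (scale_measure (ennreal t) lebesgue) (wmeas w)" for t
    by (simp add: X_def)
  have sX: "X t \<in> sets lebesgue" for t unfolding X_def by (rule sets_stop_set[OF r])
  have YX: "X \<tau>' \<subseteq> X \<tau>" unfolding X_def stop_set_def using le by (auto intro: less_le_trans)
  let ?Y = "X \<tau>'"
  \<comment> \<open>This density is Lebesgue measure restricted to \<open>?Y\<close>, so the decay
    becomes a comparison of two measures on first stopped cells.\<close>
  have dens: "emeasure (density lebesgue (indicator ?Y)) Z = ?L (?Y \<inter> Z)" if "Z \<in> sets lebesgue" for Z
  proof -
    have "emeasure (density lebesgue (indicator ?Y)) Z = (\<integral>\<^sup>+x. indicator ?Y x * indicator Z x \<partial>lebesgue)"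
      by (rule emeasure_density) (use sX that in auto)
    also have "\<dots> = (\<integral>\<^sup>+x. indicator (?Y \<inter> Z) x \<partial>lebesgue)"
      by (intro nn_integral_cong) (auto simp: indicator_def)
    also have "\<dots> = ?L (?Y \<inter> Z)" using sX that by (intro nn_integral_indicator) auto
    finally show ?thesis .
  qed
  have "emeasure (density lebesgue (indicator ?Y)) (X \<tau>) \<le> emeasure (scale_measure (ennreal (1 - \<eta>)) lebesgue) (X \<tau>)"
    unfolding X_eq[of \<tau>]
  proof (rule stop_set_le[OF r])
    fix k x assume x: "x \<in> dcell a r 0 a"
      and lt: "?W (dcell a r k x) < emeasure (scale_measure (ennreal \<tau>) lebesgue) (dcell a r k x)"
      and prev: "\<And>j. j < k \<Longrightarrow> emeasure (scale_measure (ennreal \<tau>) lebesgue) (dcell a r j x) \<le> ?W (dcell a r j x)"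
    have "k \<noteq> 0" using lt tau(2) dcell_eq[OF x] by (metis emeasure_scale_measure not_less)
    then obtain i where i: "k = Suc i" by (cases k) auto
    let ?C = "dcell a r k x"
    have sC: "?C \<in> sets lebesgue" by (rule sets_dcell[OF r])
    have CD: "?C \<subseteq> dcell a r 0 a" using dcell_antimono[of 0 k a r x] dcell_eq[OF x] by auto
    define c where "c = (r / 2 ^ k) ^ DIM('a)"
    have c: "?L ?C = ennreal c" "c > 0" using r by (auto simp: c_def emeasure_lebesgue_dcell simp del: emeasure_completion)
    define v where "v = measure (wmeas w) ?C"
    have v: "?W ?C = ennreal v"
      unfolding v_def using wmeas_dcell_finite[OF w r, of a k x] by (intro emeasure_eq_ennreal_measure) auto
    have "ennreal \<tau> * ?L ?C \<le> ennreal \<tau> * ?L (dcell a r i x)"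
      using dcell_Suc_subset[of a r i x] sets_dcell[OF r] unfolding i by (intro mult_left_mono emeasure_mono) auto
    also have "\<dots> \<le> ?W (dcell a r i x)" using prev[of i] i by simp
    also have "\<dots> \<le> ennreal B * ?W ?C" unfolding i by (rule dbl)
    finally have "ennreal (\<tau> * c) \<le> ennreal (B * v)"
      unfolding c v using tau(1) c(2) B by (simp add: ennreal_mult v_def)
    then have cv: "\<tau> * c \<le> B * v" using B by (simp add: ennreal_le_iff v_def)
    then have v0: "v > 0"
      using tau c B by (smt (verit) mult_pos_pos zero_less_mult_iff)
    have WY: "?W (?Y \<inter> ?C) \<le> ennreal \<tau>' * ?L ?C"
    proof -
      define S where "S l y \<longleftrightarrow> dcell a r l y \<subseteq> ?C \<and> ?W (dcell a r l y) < ennreal \<tau>' * ?L (dcell a r l y)" for l y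
      have eq: "?Y \<inter> ?C = {y. \<exists>l. S l y}"
      proof (intro set_eqI iffI)
        fix y assume "y \<in> {y. \<exists>l. S l y}"
        then show "y \<in> ?Y \<inter> ?C"
          using CD dcell_self by (fastforce simp: S_def X_def stop_set_def)
      next
        fix y assume y: "y \<in> ?Y \<inter> ?C"
        then obtain l where l: "?W (dcell a r l y) < ennreal \<tau>' * ?L (dcell a r l y)"
          by (auto simp: X_def stop_set_def)
        \<comment> \<open>Before generation \<open>k\<close> not even the higher level
          \<open>\<tau>\<close> is violated, so a cell witnessing the lower level lies inside
          \<open>?C\<close>.\<close>
        have "k \<le> l"
        proof (rule ccontr)
          assume "\<not> k \<le> l"
          then have "dcell a r l y = dcell a r l x" "l < k"
            using y dcell_mono_eq[of l k y a r x] by simp_all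
          then show False
            using prev[of l] l le[of "?L (dcell a r l x)"] by (simp del: emeasure_completion)
        qed
        then have "dcell a r l y \<subseteq> ?C"
          using dcell_antimono[of k l a r y] dcell_eq[of y a r k x] y by auto
        then show "y \<in> {y. \<exists>l. S l y}" using l by (auto simp: S_def)
      qed
      have "?W (?Y \<inter> ?C) \<le> emeasure (scale_measure (ennreal \<tau>') lebesgue) (?Y \<inter> ?C)"
        unfolding eq by (rule stopped_le[OF r]) (use dcell_eq in \<open>fastforce simp: S_def less_imp_le\<close>)+
      also have "\<dots> \<le> ennreal \<tau>' * ?L ?C"
        using sX sC by (simp del: emeasure_completion) (intro mult_left_mono emeasure_mono, auto)
      finally show ?thesis .
    qed
    have "\<tau>' * c \<le> v / 4"
      using cv B by (simp add: \<tau>'_def field_simps)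
    then have WY': "?W (?Y \<inter> ?C) \<le> ennreal (v / 4)"
      using WY tau' c by (smt (verit) ennreal_leI ennreal_mult less_imp_le order_trans)
    let ?E = "?C - ?Y"
    have split: "(?Y \<inter> ?C) \<inter> ?E = {}" "(?Y \<inter> ?C) \<union> ?E = ?C" by auto
    have splitW: "?W (?Y \<inter> ?C) + ?W ?E = ?W ?C"
      using plus_emeasure[of "?Y \<inter> ?C" "wmeas w" ?E] sX sC unfolding split by auto
    have splitL: "?L (?Y \<inter> ?C) + ?L ?E = ?L ?C"
      using plus_emeasure[of "?Y \<inter> ?C" lebesgue ?E] sX sC unfolding split by blast
    define y e where "y = measure lebesgue (?Y \<inter> ?C)" and "e = measure lebesgue ?E"
    have y: "?L (?Y \<inter> ?C) = ennreal y"
      unfolding y_def using splitL c by (intro emeasure_eq_ennreal_measure) (metis ennreal_add_eq_top ennreal_neq_top)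
    have e: "?L ?E = ennreal e"
      unfolding e_def using splitL c by (intro emeasure_eq_ennreal_measure) (metis ennreal_add_eq_top ennreal_neq_top)
    have ye: "y + e = c"
      using splitL y e c by (metis ennreal_inj ennreal_plus less_imp_le measure_nonneg y_def e_def add_nonneg_nonneg)
    have "\<not> e \<le> \<eta> * c"
    proof
      assume "e \<le> \<eta> * c"
      let ?P = "dcube a r k x"
      have LP: "?L ?P = ?L ?C"
        by (rule emeasure_dcell_eq_dcube[OF r, symmetric]) (auto simp: absolutely_continuous_def)
      have "2 * ?W ?E \<le> ?W ?P"
      proof (rule small_set_condD[OF sm cube_dcube[OF r]])
        show "?E \<subseteq> ?P" using dcell_subset_dcube[OF r, of a k x] by auto
        show "?L ?E \<le> ennreal \<eta> * ?L ?P"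
          unfolding LP c e using \<open>e \<le> \<eta> * c\<close> eta c(2) by (simp add: ennreal_leI flip: ennreal_mult)
      qed (use sX sC in auto)
      also have "\<dots> = ennreal v" using v wmeas_dcell[OF w r, of a k x] by simp
      finally have E1: "2 * ?W ?E \<le> ennreal v" .
      define p q where "p = measure (wmeas w) (?Y \<inter> ?C)" and "q = measure (wmeas w) ?E"
      have p: "?W (?Y \<inter> ?C) = ennreal p"
        unfolding p_def using splitW v by (intro emeasure_eq_ennreal_measure) (metis ennreal_add_eq_top ennreal_neq_top)
      have q: "?W ?E = ennreal q"
        unfolding q_def using splitW v by (intro emeasure_eq_ennreal_measure) (metis ennreal_add_eq_top ennreal_neq_top)
      have "p + q = v"
        using splitW p q v v0 by (metis ennreal_inj ennreal_plus less_imp_le measure_nonneg p_def q_def add_nonneg_nonneg)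
      moreover have "p \<le> v / 4" using WY' p v0 by (simp add: ennreal_le_iff)
      moreover have "ennreal (2 * q) \<le> ennreal v" using E1 q by (simp add: ennreal_mult q_def)
      then have "2 * q \<le> v" using v0 by (simp add: ennreal_le_iff)
      ultimately show False using v0 by linarith
    qed
    then have "y \<le> (1 - \<eta>) * c" using ye by (simp add: algebra_simps)
    then have "ennreal y \<le> ennreal (1 - \<eta>) * ennreal c"
      using eta c(2) by (simp add: ennreal_leI flip: ennreal_mult)
    then show "emeasure (density lebesgue (indicator ?Y)) ?C \<le> emeasure (scale_measure (ennreal (1 - \<eta>)) lebesgue) ?C"
      by (simp only: dens[OF sC] emeasure_scale_measure y c)
  qed auto
  moreover have "?Y \<inter> X \<tau> = ?Y" using YX by auto
  ultimately show ?thesis by (simp only: dens[OF sX] emeasure_scale_measure \<tau>'_def[symmetric])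
qed

text \<open>On the part \<open>F\<close> of the complement where \<open>w < \<tau>\<close>,
  differentiation gives mass at least \<open>\<tau>\<close> times the measure of \<open>F\<close>.
  The pointwise inequality gives strictly less unless \<open>F\<close> is null.\<close>

lemma AE_off_stop_set:
  fixes a :: "'a::euclidean_space"
  assumes w: "weight w" and r: "r > 0"
  shows "AE x in lebesgue. x \<in> dcell a r 0 a - stop_set a r (scale_measure (ennreal \<tau>) lebesgue) (wmeas w) \<longrightarrow> \<tau> \<le> w x"
proof -
  let ?X = "stop_set a r (scale_measure (ennreal \<tau>) lebesgue) (wmeas w)"
  define F where "F = (dcell a r 0 a - ?X) \<inter> {x. w x < \<tau>}"
  have wm: "w \<in> borel_measurable lebesgue" by (rule weight_measurable[OF w])
  then have "{x \<in> space lebesgue. w x < \<tau>} \<in> sets lebesgue" by measurable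
  then have sF: "F \<in> sets lebesgue" using r by (auto simp: F_def)
  have "emeasure (scale_measure (ennreal \<tau>) lebesgue) F \<le> emeasure (wmeas w) F"
    using wmeas_dcell_finite[OF w r, of a 0 a]
    by (intro off_stop_set_le[OF r _ _ ac_wmeas[OF w] _ sF]) (auto simp: F_def)
  then have le: "(\<integral>\<^sup>+x\<in>F. ennreal \<tau> \<partial>lebesgue) \<le> (\<integral>\<^sup>+x\<in>F. ennreal (w x) \<partial>lebesgue)"
    using sF by (simp add: emeasure_wmeas[OF w sF] nn_integral_cmult_indicator del: emeasure_completion)
  have fin: "(\<integral>\<^sup>+x\<in>F. ennreal (w x) \<partial>lebesgue) \<noteq> \<infinity>"
  proof -
    have "emeasure (wmeas w) F \<le> emeasure (wmeas w) (dcell a r 0 a)"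
      using r by (intro emeasure_mono) (auto simp: F_def)
    then show ?thesis
      using wmeas_dcell_finite[OF w r, of a 0 a] by (auto simp: emeasure_wmeas[OF w sF] top_unique)
  qed
  have "AE x in lebesgue. ennreal \<tau> * indicator F x \<le> ennreal (w x) * indicator F x"
  proof (rule ccontr)
    assume n: "\<not> (AE x in lebesgue. ennreal \<tau> * indicator F x \<le> ennreal (w x) * indicator F x)"
    have "(\<integral>\<^sup>+x\<in>F. ennreal (w x) \<partial>lebesgue) < (\<integral>\<^sup>+x\<in>F. ennreal \<tau> \<partial>lebesgue)"
    proof (rule nn_integral_less[OF _ _ fin _ n])
      show "AE x in lebesgue. ennreal (w x) * indicator F x \<le> ennreal \<tau> * indicator F x"
        by (intro AE_I2) (auto simp: F_def indicator_def intro!: ennreal_leI)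
    qed (use sF wm in measurable)
    then show False using le by simp
  qed
  then show ?thesis
  proof eventually_elim
    case (elim x)
    show ?case
    proof
      assume x: "x \<in> dcell a r 0 a - ?X"
      have "w x \<ge> 0" using w by (simp add: weight_def)
      then show "\<tau> \<le> w x"
        using elim x by (cases "w x < \<tau>") (auto simp: F_def ennreal_le_iff2 split: if_splits)
    qed
  qed
qed

text \<open>At a zero of \<open>w\<close>, \<open>powr\<close> would return 0; the value infinity
  follows the convention of \<open>Ap_const\<close>, where \<open>d = 1 / (p - 1)\<close>.\<close>

definition npow :: "('a \<Rightarrow> real) \<Rightarrow> real \<Rightarrow> 'a \<Rightarrow> ennreal" where
  "npow w d x = (if w x = 0 then \<infinity> else ennreal (w x powr (- d)))"

lemma npow_measurable:
  fixes w :: "'a::euclidean_space \<Rightarrow> real"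
  assumes "weight w" shows "npow w d \<in> borel_measurable lebesgue"
  using weight_measurable[OF assms] unfolding npow_def by measurable

lemma npow_le:
  assumes "0 < t" "t \<le> w x" "0 \<le> d"
  shows "npow w d x \<le> ennreal (t powr (- d))"
  using assms by (auto simp: npow_def intro!: ennreal_leI powr_mono2')

text \<open>The low level sets \<open>X k\<close> for \<open>s / (4 * B) ^ k\<close> decay like
  \<open>(1 - \<eta>) ^ k\<close>, while the bound for the negative power grows by
  \<open>b = (4 * B) powr d\<close> per level. The choice of \<open>d\<close> keeps the product
  ratio at most \<open>1 - \<eta> / 2\<close>, so a geometric series converges.\<close>

lemma avg_npow_bound:
  fixes w :: "'a::euclidean_space \<Rightarrow> real"
  assumes sm: "small_set_cond \<eta> w"
    and w: "weight w" and eta: "0 < \<eta>" "\<eta> \<le> 1" and B: "B \<ge> 1"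
    and dbl: "\<And>a r k x. r > 0 \<Longrightarrow> emeasure (wmeas w) (dcell a r k x) \<le> ennreal B * emeasure (wmeas w) (dcell a r (Suc k) x)"
    and d: "d > 0" "(4 * B) powr d \<le> 1 + \<eta> / 2"
    and Q: "cube Q" and s: "s > 0" "emeasure (wmeas w) Q = ennreal s * emeasure lebesgue Q"
  shows "(\<integral>\<^sup>+x\<in>Q. npow w d x \<partial>lebesgue) \<le> ennreal (s powr (- d) * (4 / \<eta>)) * emeasure lebesgue Q"
proof -
  let ?W = "emeasure (wmeas w)" and ?L = "emeasure lebesgue"
  obtain a r where r: "r > 0" and Qa: "Q = cbox a (a + r *\<^sub>R One)"
    using Q by (auto simp: cube_def)
  have Qd: "Q = dcube a r 0 a" by (simp add: Qa dcube_0[OF r])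
  let ?D = "dcell a r 0 a"
  define q where "q = r ^ DIM('a)"
  have q0: "q > 0" using r by (simp add: q_def)
  have LD: "?L ?D = ennreal q" using emeasure_lebesgue_dcell[OF r, of a 0 a] by (simp add: q_def del: emeasure_completion)
  have LQ: "?L Q = ennreal q" using r unfolding Qa q_def by (intro emeasure_lebesgue_cube) simp
  have WD: "?W ?D = ennreal s * ?L ?D"
    using s(2) wmeas_dcell[OF w r, of a 0 a] Qd LD LQ by simp
  define \<tau> where "\<tau> k = s / (4 * B) ^ k" for k
  have tau0: "\<tau> k > 0" for k using s B by (simp add: \<tau>_def)
  have tau_le: "\<tau> k \<le> s" for k
    using s B one_le_power[of "4 * B" k] by (simp add: \<tau>_def divide_le_eq mult_le_cancel_left1)
  have tau_Suc: "\<tau> (Suc k) = \<tau> k / (4 * B)" for k by (simp add: \<tau>_def)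
  define X where "X k = stop_set a r (scale_measure (ennreal (\<tau> k)) lebesgue) (wmeas w)" for k
  have sX: "X k \<in> sets lebesgue" for k unfolding X_def by (rule sets_stop_set[OF r])
  have LX: "?L (X k) \<le> ennreal ((1 - \<eta>) ^ k * q)" for k
  proof (induction k)
    case 0
    have "?L (X 0) \<le> ?L ?D" using r by (intro emeasure_mono) (auto simp: X_def stop_set_def)
    then show ?case by (simp add: LD)
  next
    case (Suc k)
    have "?L (X (Suc k)) \<le> ennreal (1 - \<eta>) * ?L (X k)"
      unfolding X_def tau_Suc
    proof (rule stop_set_decay[OF sm w r _ eta(2) B dbl[OF r] tau0])
      show "ennreal (\<tau> k) * ?L ?D \<le> ?W ?D"
        unfolding WD by (intro mult_right_mono ennreal_leI tau_le) simp
    qed (use eta in auto)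
    also have "\<dots> \<le> ennreal (1 - \<eta>) * ennreal ((1 - \<eta>) ^ k * q)" by (intro mult_left_mono Suc) simp
    also have "\<dots> = ennreal ((1 - \<eta>) ^ Suc k * q)" using eta q0 by (simp add: mult.assoc flip: ennreal_mult)
    finally show ?case .
  qed
  have null: "(\<Inter>k. X k) \<in> null_sets lebesgue"
  proof (rule null_setsI)
    have "?L (\<Inter>k. X k) \<le> ennreal ((1 - \<eta>) ^ k * q)" for k
      using LX[of k] emeasure_mono[of "\<Inter>k. X k" "X k" lebesgue] sX by (meson INT_lower UNIV_I order_trans)
    moreover have "(\<lambda>k. ennreal ((1 - \<eta>) ^ k * q)) \<longlonglongrightarrow> ennreal (0 * q)"
      using eta by (intro tendsto_ennrealI tendsto_mult LIMSEQ_power_zero tendsto_const) simp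
    ultimately have "?L (\<Inter>k. X k) \<le> ennreal (0 * q)"
      by (intro LIMSEQ_le_const[of "\<lambda>k. ennreal ((1 - \<eta>) ^ k * q)"]) blast+
    then show "?L (\<Inter>k. X k) = 0" by simp
    show "(\<Inter>k. X k) \<in> sets lebesgue" using sX by (intro sets.countable_INT) auto
  qed
  define b where "b = (4 * B) powr d"
  have b: "b > 0" "b \<le> 1 + \<eta> / 2" using B d by (auto simp: b_def)
  have tau_powr: "\<tau> k powr (- d) = s powr (- d) * b ^ k" for k
  proof -
    have "\<tau> k powr (- d) = s powr (- d) / ((4 * B) ^ k) powr (- d)"
      unfolding \<tau>_def by (rule powr_divide)
    also have "((4 * B) ^ k) powr (- d) = inverse (b ^ k)"
    proof -
      define b' where "b' = 4 * B"
      have "b' > 0" using B by (simp add: b'_def)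
      then show ?thesis
        unfolding b_def b'_def[symmetric] by (simp add: powr_minus powr_powr mult.commute flip: powr_realpow)
    qed
    finally show ?thesis by (simp add: divide_inverse)
  qed
  \<comment> \<open>The first term serves points outside \<open>X 0\<close>; the \<open>k\<close>-th
    term of the series serves points in \<open>X k\<close> whose first avoided set is
    \<open>X (Suc k)\<close>.\<close>
  define g where "g x = ennreal (s powr (- d)) * indicator ?D x + (\<Sum>k. ennreal (\<tau> (Suc k) powr (- d)) * indicator (X k) x)" for x
  have "AE x in lebesgue. npow w d x * indicator Q x \<le> g x"
  proof -
    have "AE x in lebesgue. x \<notin> Q - ?D"
      using dcube_diff_dcell_null[OF r, of a 0 a] unfolding Qd by (rule AE_not_in)
    moreover have "AE x in lebesgue. x \<notin> (\<Inter>k. X k)" using null by (rule AE_not_in)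
    moreover have "AE x in lebesgue. \<forall>k. x \<in> ?D - X k \<longrightarrow> \<tau> k \<le> w x"
      unfolding AE_all_countable X_def by (intro allI AE_off_stop_set[OF w r])
    ultimately show ?thesis
    proof eventually_elim
      case (elim x)
      show ?case
      proof (cases "x \<in> Q")
        case True
        then have xD: "x \<in> ?D" using elim by auto
        have ex: "\<exists>k. x \<notin> X k" using elim by auto
        define k where "k = (LEAST k. x \<notin> X k)"
        have k: "x \<notin> X k" unfolding k_def by (rule LeastI_ex[OF ex])
        have "\<tau> k \<le> w x" using elim(3) xD k by auto
        then have n: "npow w d x \<le> ennreal (\<tau> k powr (- d))" using tau0 d by (intro npow_le) auto
        show ?thesis
        proof (cases k)
          case 0
          have "ennreal (\<tau> k powr (- d)) \<le> g x"
            using xD 0 by (simp add: g_def \<tau>_def)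
          with n True show ?thesis by (simp add: order_trans)
        next
          case (Suc j)
          have xj: "x \<in> X j" using not_less_Least[of j "\<lambda>k. x \<notin> X k"] Suc k_def by auto
          have "(\<Sum>i\<in>{j}. ennreal (\<tau> (Suc i) powr (- d)) * indicator (X i) x)
              \<le> (\<Sum>i. ennreal (\<tau> (Suc i) powr (- d)) * indicator (X i) x)"
            by (rule sum_le_suminf) auto
          then have "ennreal (\<tau> k powr (- d)) \<le> (\<Sum>i. ennreal (\<tau> (Suc i) powr (- d)) * indicator (X i) x)"
            using xj Suc by simp
          also have "\<dots> \<le> g x" by (simp add: g_def)
          finally show ?thesis using n True by (simp add: order_trans)
        qed
      qed simp
    qed
  qed
  then have "(\<integral>\<^sup>+x\<in>Q. npow w d x \<partial>lebesgue) \<le> (\<integral>\<^sup>+x. g x \<partial>lebesgue)"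
    by (rule nn_integral_mono_AE)
  also have "\<dots> = ennreal (s powr (- d)) * ?L ?D + (\<Sum>k. ennreal (\<tau> (Suc k) powr (- d)) * ?L (X k))"
  proof -
    have sD: "?D \<in> sets lebesgue" by (rule sets_dcell[OF r])
    have mX: "(\<lambda>x. ennreal (\<tau> (Suc k) powr (- d)) * indicator (X k) x) \<in> borel_measurable lebesgue" for k
      using sX[of k] by measurable
    have mD: "(\<lambda>x. ennreal (s powr (- d)) * indicator ?D x) \<in> borel_measurable lebesgue"
      using sD by measurable
    show ?thesis
      unfolding g_def nn_integral_add[OF mD borel_measurable_suminf_order[OF mX]] nn_integral_suminf[OF mX]
      by (simp only: nn_integral_cmult_indicator[OF sX] nn_integral_cmult_indicator[OF sD])
  qed
  also have "(\<Sum>k. ennreal (\<tau> (Suc k) powr (- d)) * ?L (X k))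
      \<le> (\<Sum>k. ennreal (s powr (- d) * q * (1 + \<eta> / 2) * (1 - \<eta> / 2) ^ k))"
  proof (intro suminf_le)
    fix k
    have "ennreal (\<tau> (Suc k) powr (- d)) * ?L (X k) \<le> ennreal (\<tau> (Suc k) powr (- d)) * ennreal ((1 - \<eta>) ^ k * q)"
      by (intro mult_left_mono LX) simp
    also have "\<dots> = ennreal (\<tau> (Suc k) powr (- d) * ((1 - \<eta>) ^ k * q))"
      using eta q0 by (simp add: ennreal_mult)
    also have "\<dots> \<le> ennreal (s powr (- d) * q * (1 + \<eta> / 2) * (1 - \<eta> / 2) ^ k)"
    proof (rule ennreal_leI)
      have "b * (1 - \<eta>) \<le> (1 + \<eta> / 2) * (1 - \<eta>)" using b eta by (intro mult_right_mono) auto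
      also have "\<dots> \<le> 1 - \<eta> / 2" using eta by (simp add: algebra_simps)
      finally have "(b * (1 - \<eta>)) ^ k \<le> (1 - \<eta> / 2) ^ k" using b eta by (intro power_mono) auto
      then have "b * (b * (1 - \<eta>)) ^ k \<le> (1 + \<eta> / 2) * (1 - \<eta> / 2) ^ k"
        using b eta by (intro mult_mono) auto
      then have "s powr (- d) * q * (b * (b * (1 - \<eta>)) ^ k) \<le> s powr (- d) * q * ((1 + \<eta> / 2) * (1 - \<eta> / 2) ^ k)"
        using q0 by (intro mult_left_mono) auto
      then show "\<tau> (Suc k) powr (- d) * ((1 - \<eta>) ^ k * q) \<le> s powr (- d) * q * (1 + \<eta> / 2) * (1 - \<eta> / 2) ^ k"
        unfolding tau_powr by (simp add: power_mult_distrib mult_ac)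
    qed
    finally show "ennreal (\<tau> (Suc k) powr (- d)) * ?L (X k) \<le> ennreal (s powr (- d) * q * (1 + \<eta> / 2) * (1 - \<eta> / 2) ^ k)" .
  qed auto
  also have "(\<Sum>k. ennreal (s powr (- d) * q * (1 + \<eta> / 2) * (1 - \<eta> / 2) ^ k)) = ennreal (s powr (- d) * q * (1 + \<eta> / 2) * (2 / \<eta>))"
  proof (rule suminf_ennreal_eq)
    have "(\<lambda>k. (1 - \<eta> / 2) ^ k) sums (1 / (1 - (1 - \<eta> / 2)))" using eta by (intro geometric_sums) auto
    then have "(\<lambda>k. (1 - \<eta> / 2) ^ k) sums (2 / \<eta>)" by simp
    then show "(\<lambda>k. s powr (- d) * q * (1 + \<eta> / 2) * (1 - \<eta> / 2) ^ k) sums (s powr (- d) * q * (1 + \<eta> / 2) * (2 / \<eta>))"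
      by (rule sums_mult)
    show "0 \<le> s powr (- d) * q * (1 + \<eta> / 2) * (1 - \<eta> / 2) ^ k" for k using eta q0 by simp
  qed
  also have "ennreal (s powr (- d)) * ?L ?D + ennreal (s powr (- d) * q * (1 + \<eta> / 2) * (2 / \<eta>))
      = ennreal (s powr (- d) * q + s powr (- d) * q * (1 + \<eta> / 2) * (2 / \<eta>))"
    unfolding LD using eta q0 by (simp add: ennreal_mult)
  also have "\<dots> \<le> ennreal (s powr (- d) * (4 / \<eta>) * q)"
  proof (rule ennreal_leI)
    \<comment> \<open>The left side equals \<open>2 + 2 / \<eta>\<close>, and
      \<open>\<eta> \<le> 1\<close>.\<close>
    have "1 + (1 + \<eta> / 2) * (2 / \<eta>) \<le> 4 / \<eta>" using eta by (simp add: field_simps)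
    then have "s powr (- d) * q * (1 + (1 + \<eta> / 2) * (2 / \<eta>)) \<le> s powr (- d) * q * (4 / \<eta>)"
      using q0 by (intro mult_left_mono) auto
    then show "s powr (- d) * q + s powr (- d) * q * (1 + \<eta> / 2) * (2 / \<eta>) \<le> s powr (- d) * (4 / \<eta>) * q"
      by (subst (asm) distrib_left) (simp only: mult_1_right mult.assoc mult.commute[of q "4 / \<eta>"])
  qed
  also have "\<dots> = ennreal (s powr (- d) * (4 / \<eta>)) * ?L Q"
    unfolding LQ using eta q0 by (intro ennreal_mult) auto
  finally show ?thesis by (simp add: add_left_mono)
qed

text \<open>Jensen's inequality for a smaller power, obtained by integrating Young's inequality.\<close>

lemma nn_integral_npow_mono:
  fixes w :: "'a::euclidean_space \<Rightarrow> real"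
  assumes w: "weight w" and Q: "cube Q" and d: "0 < d'" "d' \<le> d" and c: "c > 0"
    and le: "(\<integral>\<^sup>+x\<in>Q. npow w d x \<partial>lebesgue) \<le> ennreal c * emeasure lebesgue Q"
  shows "(\<integral>\<^sup>+x\<in>Q. npow w d' x \<partial>lebesgue) \<le> ennreal (c powr (d' / d)) * emeasure lebesgue Q"
proof -
  define \<theta> where "\<theta> = d' / d"
  have th: "0 < \<theta>" "\<theta> \<le> 1" "d * \<theta> = d'" using d by (auto simp: \<theta>_def)
  \<comment> \<open>This factor normalizes Young's inequality at \<open>y = c\<close>, where it is
    an equality, so that the integrated bound is exactly \<open>c powr \<theta>\<close>.\<close>
  define K where "K = c powr (\<theta> - 1)"
  have K: "K > 0" "K * c = c powr \<theta>" using c by (auto simp: K_def powr_diff)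
  have pw: "npow w d' x \<le> ennreal (K * \<theta>) * npow w d x + ennreal (K * (1 - \<theta>) * c)" for x
  proof (cases "w x = 0")
    case True
    \<comment> \<open>The right-hand side is infinite as well, because the coefficient
      \<open>K * \<theta>\<close> is positive.\<close>
    then show ?thesis using K th by (simp add: npow_def ennreal_mult_top)
  next
    case False
    then have wx: "w x > 0" using w by (auto simp: weight_def less_le)
    define y where "y = w x powr (- d)"
    have y: "y > 0" using wx by (simp add: y_def)
    have "w x powr (- d') = y powr \<theta>" by (simp add: y_def powr_powr th(3)[symmetric])
    also have "\<dots> = K * (y powr \<theta> * c powr (1 - \<theta>))"
      using c by (simp add: K_def mult.left_commute flip: powr_add)
    also have "\<dots> \<le> K * (\<theta> * y + (1 - \<theta>) * c)"
      using K th y c by (intro mult_left_mono Youngs_inequality_0) auto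
    finally have "ennreal (w x powr (- d')) \<le> ennreal (K * \<theta> * y + K * (1 - \<theta>) * c)"
      by (intro ennreal_leI) (simp add: algebra_simps)
    also have "\<dots> = ennreal (K * \<theta>) * ennreal y + ennreal (K * (1 - \<theta>) * c)"
      using K th y c by (simp add: ennreal_mult)
    finally show ?thesis using False by (simp add: npow_def y_def)
  qed
  have "(\<integral>\<^sup>+x\<in>Q. npow w d' x \<partial>lebesgue) \<le>
      (\<integral>\<^sup>+x. ennreal (K * \<theta>) * (npow w d x * indicator Q x) + ennreal (K * (1 - \<theta>) * c) * indicator Q x \<partial>lebesgue)"
    using pw by (intro nn_integral_mono) (auto simp: indicator_def)
  also have "\<dots> = ennreal (K * \<theta>) * (\<integral>\<^sup>+x\<in>Q. npow w d x \<partial>lebesgue) + ennreal (K * (1 - \<theta>) * c) * emeasure lebesgue Q"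
    using npow_measurable[OF w, of d] sets_cube[OF Q]
    by (subst nn_integral_add) (auto simp: nn_integral_cmult nn_integral_cmult_indicator simp del: emeasure_completion)
  also have "\<dots> \<le> ennreal (K * \<theta>) * (ennreal c * emeasure lebesgue Q) + ennreal (K * (1 - \<theta>) * c) * emeasure lebesgue Q"
    by (intro add_right_mono mult_left_mono le) simp
  also have "\<dots> = ennreal (K * \<theta> * c + K * (1 - \<theta>) * c) * emeasure lebesgue Q"
    using K th c by (simp add: ennreal_mult distrib_right mult.assoc del: emeasure_completion)
  also have "K * \<theta> * c + K * (1 - \<theta>) * c = c powr \<theta>" using K by (simp add: algebra_simps)
  finally show ?thesis by (simp add: \<theta>_def)
qed

section \<open>From integrals of negative powers to the \<open>A_p\<close> constant\<close>

lemma divide_emeasure_cube_le: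
  assumes Q: "cube Q" and le: "z \<le> ennreal c * emeasure lebesgue Q"
  shows "z / emeasure lebesgue Q \<le> ennreal c"
proof -
  obtain q where "q > 0" "emeasure lebesgue Q = ennreal q"
    using Q emeasure_lebesgue_cube unfolding cube_def by (metis less_imp_le zero_less_power)
  then have "ennreal c * emeasure lebesgue Q / emeasure lebesgue Q = ennreal c"
    by (simp add: ennreal_times_divide[symmetric] ennreal_divide_self)
  then show ?thesis using divide_right_mono_ennreal[OF le, of "emeasure lebesgue Q"] by simp
qed

lemma epowr_le:
  assumes "X \<le> ennreal y" "y \<ge> 0" "e > 0"
  shows "epowr X e \<le> ennreal (y powr e)"
proof -
  have "X \<noteq> \<infinity>" using assms(1) by (auto simp: top_unique)
  moreover have "enn2real X \<le> y" using enn2real_mono[OF assms(1)] assms(2) by simp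
  ultimately show ?thesis
    using assms by (auto simp: epowr_def intro!: ennreal_leI powr_mono2)
qed

text \<open>After lowering the exponent from \<open>d\<close> to \<open>1 / (p - 1)\<close>, the
  outer power \<open>p - 1\<close> removes all dependence on \<open>p\<close>. It leaves
  \<open>c powr (1 / d)\<close>, whose factor \<open>inverse s\<close> cancels the average of
  \<open>w\<close>.\<close>

lemma Ap_const_bound:
  fixes w :: "'a::euclidean_space \<Rightarrow> real"
  assumes sm: "small_set_cond \<eta> w"
    and w: "weight w" and eta: "0 < \<eta>" "\<eta> \<le> 1" and B: "B \<ge> 1"
    and dbl: "\<And>a r k x. r > 0 \<Longrightarrow> emeasure (wmeas w) (dcell a r k x) \<le> ennreal B * emeasure (wmeas w) (dcell a r (Suc k) x)"
    and d: "d > 0" "(4 * B) powr d \<le> 1 + \<eta> / 2" and p: "1 / d \<le> p - 1"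
  shows "Ap_const p w \<le> ennreal ((4 / \<eta>) powr (1 / d))"
  unfolding Ap_const_def
proof (rule SUP_least)
  fix Q :: "'a set" assume "Q \<in> {Q. cube Q}"
  then have Q: "cube Q" by simp
  have p1: "p > 1" using d p by (smt (verit) divide_pos_pos)
  let ?f = "\<lambda>x. if w x = 0 then \<infinity> else ennreal (w x powr (- 1 / (p - 1)))"
  have f: "?f = npow w (1 / (p - 1))" by (auto simp: npow_def fun_eq_iff)
  obtain q where q: "q > 0" "emeasure lebesgue Q = ennreal q"
    using Q emeasure_lebesgue_cube unfolding cube_def by (metis less_imp_le zero_less_power)
  define v where "v = measure (wmeas w) Q"
  have v: "emeasure (wmeas w) Q = ennreal v"
    unfolding v_def using wmeas_cube_finite[OF w Q] by (intro emeasure_eq_ennreal_measure) auto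
  define s where "s = v / q"
  have avgw: "avg (\<lambda>x. ennreal (w x)) Q = ennreal s"
    unfolding avg_def emeasure_wmeas[OF w sets_cube[OF Q], symmetric] v q(2) s_def
    using q by (intro divide_ennreal) (auto simp: v_def)
  show "avg (\<lambda>x. ennreal (w x)) Q * epowr (avg ?f Q) (p - 1) \<le> ennreal ((4 / \<eta>) powr (1 / d))"
  proof (cases "s = 0")
    case True
    \<comment> \<open>The second factor may be infinite here, but zero times infinity is zero in
      \<open>ennreal\<close>.\<close>
    then show ?thesis by (simp add: avgw)
  next
    case False
    then have s: "s > 0" using q by (simp add: s_def v_def less_le)
    have Ws: "emeasure (wmeas w) Q = ennreal s * emeasure lebesgue Q"
      unfolding v q(2) using s q by (simp add: s_def flip: ennreal_mult)
    define c where "c = s powr (- d) * (4 / \<eta>)"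
    have c: "c > 0" using s eta by (simp add: c_def)
    have "(\<integral>\<^sup>+x\<in>Q. npow w d x \<partial>lebesgue) \<le> ennreal c * emeasure lebesgue Q"
      unfolding c_def by (rule avg_npow_bound[OF sm w eta B dbl d Q s Ws])
    moreover have "1 / (p - 1) \<le> d" using p d p1 by (simp add: field_simps)
    ultimately have "(\<integral>\<^sup>+x\<in>Q. npow w (1 / (p - 1)) x \<partial>lebesgue) \<le> ennreal (c powr (1 / (p - 1) / d)) * emeasure lebesgue Q"
      using p1 by (intro nn_integral_npow_mono[OF w Q _ _ c]) auto
    then have "avg ?f Q \<le> ennreal (c powr (1 / (p - 1) / d))"
      unfolding avg_def f by (rule divide_emeasure_cube_le[OF Q])
    then have "epowr (avg ?f Q) (p - 1) \<le> ennreal ((c powr (1 / (p - 1) / d)) powr (p - 1))"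
      using p1 by (intro epowr_le) auto
    also have "(c powr (1 / (p - 1) / d)) powr (p - 1) = c powr (1 / d)"
      using p1 by (simp add: powr_powr)
    also have "\<dots> = inverse s * (4 / \<eta>) powr (1 / d)"
    proof -
      have "c powr (1 / d) = (s powr (- d)) powr (1 / d) * (4 / \<eta>) powr (1 / d)"
        unfolding c_def using eta by (intro powr_mult)
      also have "(s powr (- d)) powr (1 / d) = inverse s"
        unfolding powr_powr using s d by (simp add: powr_minus)
      finally show ?thesis .
    qed
    finally have "ennreal s * epowr (avg ?f Q) (p - 1) \<le> ennreal s * ennreal (inverse s * (4 / \<eta>) powr (1 / d))"
      by (rule mult_left_mono) simp
    also have "\<dots> = ennreal ((4 / \<eta>) powr (1 / d))"
      using s by (simp flip: ennreal_mult)
    finally show ?thesis by (simp add: avgw)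
  qed
qed

text \<open>Testing the supremum with \<open>Q\<close> itself bounds the maximal function below by
  the average of \<open>w\<close> on \<open>Q\<close>. The lower bound on \<open>A\<close> later
  absorbs additive constants into a multiple of \<open>A\<close>.\<close>

lemma one_le_Ainf_const:
  fixes w :: "'a::euclidean_space \<Rightarrow> real"
  assumes w: "weight w" and A: "Ainf_const w \<le> ennreal A" and Q: "cube Q"
    and pos: "emeasure (wmeas w) Q \<noteq> 0"
  shows "1 \<le> A"
proof -
  let ?M = "maxop (\<lambda>y. ennreal (w y) * indicator Q y)"
  obtain q where q: "q > 0" "emeasure lebesgue Q = ennreal q"
    using Q emeasure_lebesgue_cube unfolding cube_def by (metis less_imp_le zero_less_power)
  define v where "v = measure (wmeas w) Q"
  have v: "emeasure (wmeas w) Q = ennreal v"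
    unfolding v_def using wmeas_cube_finite[OF w Q] by (intro emeasure_eq_ennreal_measure) auto
  have v0: "v > 0" using pos v by (simp add: v_def zero_less_measure_iff)
  have av: "avg (\<lambda>y. ennreal (w y) * indicator Q y) Q = ennreal (v / q)"
  proof -
    have "(\<integral>\<^sup>+y\<in>Q. ennreal (w y) * indicator Q y \<partial>lebesgue) = (\<integral>\<^sup>+y\<in>Q. ennreal (w y) \<partial>lebesgue)"
      by (intro nn_integral_cong) (auto simp: indicator_def)
    then show ?thesis
      using q v0 by (simp add: avg_def emeasure_wmeas[OF w sets_cube[OF Q], symmetric] v divide_ennreal)
  qed
  have "ennreal (v / q) * indicator Q x \<le> ?M x * indicator Q x" for x
    using Q unfolding av[symmetric] maxop_def by (auto simp: indicator_def intro!: SUP_upper)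
  then have "(\<integral>\<^sup>+x\<in>Q. ennreal (v / q) \<partial>lebesgue) \<le> (\<integral>\<^sup>+x\<in>Q. ?M x \<partial>lebesgue)"
    by (intro nn_integral_mono) auto
  also have "\<dots> \<le> ennreal A * emeasure (wmeas w) Q" by (rule Ainf_const_bound[OF w A Q pos])
  also have "(\<integral>\<^sup>+x\<in>Q. ennreal (v / q) \<partial>lebesgue) = ennreal v"
    using sets_cube[OF Q] q v0 by (simp add: nn_integral_cmult_indicator flip: ennreal_mult del: emeasure_completion)
  finally have le: "ennreal v \<le> ennreal A * ennreal v" by (simp add: v)
  \<comment> \<open>Positivity comes first because \<open>ennreal\<close> sends negative reals to
    0.\<close>
  have "A > 0"
  proof (rule ccontr)
    assume "\<not> A > 0"
    then have "ennreal A = 0" by (simp add: ennreal_neg)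
    then show False using le v0 by simp
  qed
  then have "v \<le> A * v" using le v0 by (simp add: ennreal_le_iff flip: ennreal_mult)
  then show ?thesis using v0 by simp
qed

section \<open>Choice of constants and the degenerate weight\<close>

lemma two_powr_le:
  fixes x :: real
  assumes "0 \<le> x" "x \<le> 1"
  shows "2 powr x \<le> 1 + x"
  \<comment> \<open>Weighted arithmetic-geometric mean of 2 and 1 with weights \<open>x\<close> and
    \<open>1 - x\<close>.\<close>
  using Youngs_inequality_0[of x "1 - x" 2 1] assms by simp

text \<open>For a weight without mass the negative powers have infinite averages, but each product
  has first factor zero.\<close>

lemma Ap_const_zero:
  fixes w :: "'a::euclidean_space \<Rightarrow> real"
  assumes w: "weight w" and z: "\<And>Q. cube Q \<Longrightarrow> emeasure (wmeas w) Q = 0"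
  shows "Ap_const p w = 0"
proof -
  have "avg (\<lambda>x. ennreal (w x)) Q = 0" if "cube Q" for Q
    using z[OF that] emeasure_wmeas[OF w sets_cube[OF that]] by (simp add: avg_def)
  then have "Ap_const p w \<le> 0" unfolding Ap_const_def by (intro SUP_least) auto
  then show ?thesis by simp
qed

text \<open>The final exponent \<open>(m + 4) * N\<close> also dominates the threshold
  \<open>1 + N\<close> for \<open>p\<close>. It is at most two to the power
  \<open>3 * m + 7 + n\<close>, and \<open>m\<close> is at most a dimensional multiple of
  \<open>A\<close>; so it is a single exponential in \<open>A\<close> and the constant a double
  one.\<close>

lemma A_inf_imp_A_p:
  fixes w :: "'a::euclidean_space \<Rightarrow> real"
  assumes w: "weight w" and A: "Ainf_const w \<le> ennreal A" and A1: "A \<ge> 1"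
    and p: "exp ((real DIM('a) + 11 + 3 * 2 ^ (DIM('a) + 4)) * A) < p"
  shows "Ap_const p w \<le> ennreal (exp (exp ((real DIM('a) + 11 + 3 * 2 ^ (DIM('a) + 4)) * A)))"
proof -
  let ?n = "DIM('a)" and ?c = "real DIM('a) + 11 + 3 * 2 ^ (DIM('a) + 4)"
  define m where "m = nat \<lceil>2 ^ (?n + 3) * A\<rceil>"
  have m: "2 ^ (?n + 3) * A \<le> real m" "real m \<le> 2 ^ (?n + 3) * A + 1"
  proof -
    have "0 \<le> 2 ^ (?n + 3) * A" using A1 by simp
    then show "2 ^ (?n + 3) * A \<le> real m" "real m \<le> 2 ^ (?n + 3) * A + 1"
      unfolding m_def by linarith+
  qed
  have "1 \<le> 2 ^ (?n + 3) * A" using A1 mult_mono[of 1 "2 ^ (?n + 3)" 1 A] by simp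
  then have m2: "real m \<le> 2 ^ (?n + 4) * A" using m by (simp add: power_add)
  define \<eta> :: real where "\<eta> = 1 / 2 ^ (m + 2)"
  have eta: "0 < \<eta>" "\<eta> \<le> 1" using one_le_power[of "2::real" "m + 2"] by (simp_all only: \<eta>_def) auto
  define J where "J = ?n * 2 ^ (m + 2)"
  have J: "J \<ge> 1" "real ?n \<le> real J * \<eta>" by (auto simp: J_def \<eta>_def Suc_le_eq)
  \<comment> \<open>Chosen so that, with \<open>B = 2 ^ J\<close> and \<open>d = 1 / N\<close>, the
    power \<open>(4 * B) powr d\<close> equals \<open>2 powr (\<eta> / 2)\<close>.\<close>
  define N where "N = 2 * (J + 2) * 2 ^ (m + 2)"
  have N0: "N \<ge> 1" by (simp add: N_def Suc_le_eq)
  define d where "d = 1 / real N"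
  have d0: "d > 0" using N0 by (simp add: d_def)
  have dJ: "real (J + 2) * d = \<eta> / 2"
  proof -
    define x y :: real where "x = real (J + 2)" and "y = 2 ^ (m + 2)"
    have "x > 0" "real N = 2 * x * y" "\<eta> = 1 / y" by (simp_all add: x_def y_def N_def \<eta>_def algebra_simps)
    then show ?thesis unfolding x_def[symmetric] d_def by simp
  qed
  have sm: "small_set_cond \<eta> w"
    unfolding \<eta>_def by (rule Ainf_small_set_cond[OF w A _ m(1)]) (use A1 in simp)
  have dbl: "emeasure (wmeas w) (dcell a r k x) \<le> ennreal (2 ^ J) * emeasure (wmeas w) (dcell a r (Suc k) x)"
    if "r > 0" for a r k x
  proof -
    have e: "ennreal (2 ^ J) = 2 ^ J" by (metis ennreal_numeral ennreal_power zero_le_numeral)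
    show ?thesis unfolding e by (rule dyadic_doubling[OF sm w J that])
  qed
  have "4 * 2 ^ J = (2::real) powr real (J + 2)"
    by (subst powr_realpow) (simp_all add: power_add)
  then have "(4 * 2 ^ J) powr d = 2 powr (real (J + 2) * d)"
    by (simp only: powr_powr)
  also have "\<dots> \<le> 1 + \<eta> / 2" unfolding dJ using eta by (intro two_powr_le) auto
  finally have d1: "(4 * 2 ^ J) powr d \<le> 1 + \<eta> / 2" .
  have big: "real ((m + 4) * N) \<le> exp (?c * A)"
  proof -
    have "m + 4 \<le> 2 ^ (m + 2)" by (induction m) auto
    moreover have "N \<le> 2 ^ (2 * m + 5 + ?n)"
    proof -
      have "(2::nat) ^ 1 \<le> 2 ^ (m + 2)" by (intro power_increasing) auto
      then have "J + 2 \<le> (?n + 1) * 2 ^ (m + 2)" by (simp add: J_def)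
      also have "\<dots> \<le> 2 ^ ?n * 2 ^ (m + 2)"
        by (intro mult_right_mono) (auto simp: Suc_le_eq)
      finally have "N \<le> 2 * (2 ^ ?n * 2 ^ (m + 2)) * 2 ^ (m + 2)"
        unfolding N_def by (rule mult_right_mono[OF mult_left_mono]) auto
      also have "\<dots> = 2 ^ (1 + (?n + (m + 2)) + (m + 2))" by (simp only: power_add power_one_right)
      also have "1 + (?n + (m + 2)) + (m + 2) = 2 * m + 5 + ?n" by simp
      finally show ?thesis .
    qed
    ultimately have "(m + 4) * N \<le> 2 ^ (m + 2) * 2 ^ (2 * m + 5 + ?n)" by (intro mult_le_mono)
    also have "\<dots> = 2 ^ ((m + 2) + (2 * m + 5 + ?n))" by (simp only: power_add)
    also have "(m + 2) + (2 * m + 5 + ?n) = 3 * m + 7 + ?n" by simp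
    finally have "real ((m + 4) * N) \<le> 2 ^ (3 * m + 7 + ?n)" using of_nat_mono by fastforce
    also have "\<dots> \<le> exp 1 ^ (3 * m + 7 + ?n)"
      using exp_ge_add_one_self[of 1] by (intro power_mono) auto
    also have "\<dots> = exp (real (3 * m + 7 + ?n))" by (simp flip: exp_of_nat_mult)
    also have "\<dots> \<le> exp (?c * A)"
    proof -
      \<comment> \<open>Since \<open>A \<ge> 1\<close>, the additive part of the exponent may be
        multiplied by \<open>A\<close>; \<open>m2\<close> bounds the remaining
        \<open>3 * m\<close>.\<close>
      have "(real ?n + 11) * 1 \<le> (real ?n + 11) * A" using A1 by (intro mult_left_mono) auto
      then show ?thesis using m2 by (simp add: algebra_simps)
    qed
    finally show ?thesis .
  qed
  have "1 + real N \<le> real ((m + 4) * N)"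
  proof -
    have "1 + N \<le> 2 * N" using N0 by simp
    also have "\<dots> \<le> (m + 4) * N" by (intro mult_right_mono) auto
    finally show ?thesis by (metis of_nat_1 of_nat_add of_nat_mono)
  qed
  then have "1 / d \<le> p - 1" using big p by (simp add: d_def)
  then have "Ap_const p w \<le> ennreal ((4 / \<eta>) powr (1 / d))"
    by (intro Ap_const_bound[OF sm w eta _ dbl d0 d1]) auto
  also have "(4 / \<eta>) powr (1 / d) = 2 ^ ((m + 4) * N)"
  proof -
    have "4 / \<eta> = 2 ^ (m + 4)" by (simp add: \<eta>_def power_add)
    then show ?thesis by (simp add: d_def powr_realpow power_mult)
  qed
  also have "(2::real) ^ ((m + 4) * N) \<le> exp 1 ^ ((m + 4) * N)"
    using exp_ge_add_one_self[of 1] by (intro power_mono) auto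
  also have "\<dots> = exp (real ((m + 4) * N))" by (simp flip: exp_of_nat_mult)
  also have "\<dots> \<le> exp (exp (?c * A))" using big by simp
  finally show ?thesis by (simp add: ennreal_leI)
qed

theorem theorem1p3:
  shows "\<exists>c::real. c > 1 \<and>
    (\<forall>w::'a::euclidean_space \<Rightarrow> real. w \<in> A_inf \<longrightarrow>
      (\<forall>p::real. p > exp (c * enn2real (Ainf_const w)) \<longrightarrow>
         w \<in> A_p p \<and> Ap_const p w \<le> ennreal (exp (exp (c * enn2real (Ainf_const w))))))"
proof -
  let ?c = "real DIM('a) + 11 + 3 * 2 ^ (DIM('a) + 4)"
  have "Ap_const p w \<le> ennreal (exp (exp (?c * enn2real (Ainf_const w))))"
    if "w \<in> A_inf" and p: "p > exp (?c * enn2real (Ainf_const w))" for w :: "'a \<Rightarrow> real" and p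
  proof -
    have w: "weight w" and fin: "Ainf_const w < \<infinity>" using that by (auto simp: A_inf_def)
    have A: "Ainf_const w \<le> ennreal (enn2real (Ainf_const w))" using fin by simp
    show ?thesis
    \<comment> \<open>A cube of positive mass yields \<open>A \<ge> 1\<close>; without one, all
      averages of \<open>w\<close> vanish.\<close>
    proof (cases "\<exists>Q::'a set. cube Q \<and> emeasure (wmeas w) Q \<noteq> 0")
      case True
      then show ?thesis using A_inf_imp_A_p[OF w A _ p] one_le_Ainf_const[OF w A] by blast
    next
      case False
      then show ?thesis by (subst Ap_const_zero[OF w]) auto
    qed
  qed
  moreover have "?c > 1" by (simp add: add_pos_nonneg)
  ultimately show ?thesis
    by (intro exI[of _ ?c])
       (auto simp: A_p_def A_inf_def intro!: le_less_trans[OF _ ennreal_less_top])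
qed

end
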